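(* Let $(X,\mathsf d)$ be a proper geodesic metric space, $p>1$, $\varphi:X\to\mathbb R$ a Kantorovich potential for the cost $\mathsf d^p/p$, and let $\gamma\in G_\varphi$ be a $(\varphi,p)$-Kantorovich geodesic of length $\ell=\ell(\gamma)>0$. Assume that for a.e. $t\in(0,1)$ both maps $$(0,1)\ni\tau\mapsto\varphi_\tau(\gamma_t),\qquad (0,1)\ni\tau\mapsto\bar\varphi_\tau(\gamma_t)\qquad\text{are twice differentiable at }\tau=t,\qquad(\dagger)$$ and that moreover $\partial^2_\tau|_{\tau=t}\varphi_\tau(\gamma_t)=\partial^2_\tau|_{\tau=t}\bar\varphi_\tau(\gamma_t)$ for a.e. $t\in(0,1)$. If there exists a continuous function $z$ on $(0,1)$ for which $$\partial^2_\tau|_{\tau=t}\varphi_\tau(\gamma_t)=\partial^2_\tau|_{\tau=t}\bar\varphi_\tau(\gamma_t)=z(t)\quad\text{for a.e. }t\in(0,1),$$ then $(\dagger)$ holds for all $t\in(0,1)$, and for all $t\in(0,1)$ $$\partial^2_\tau|_{\tau=t}\varphi_\tau(\gamma_t)=\partial^2_\tau|_{\tau=t}\bar\varphi_\tau(\gamma_t)=\partial_\tau|_{\tau=t}\frac{(p-1)\ell_\tau^p(\gamma_t)}{p}=\partial_\tau|_{\tau=t}\frac{(p-1)\bar\ell_\tau^p(\gamma_t)}{p}=z(t).$$ Finally, $$\frac{z(t)-z(s)}{t-s}\ge\sqrt{\frac{s}{t}\,\frac{1-t}{1-s}}\;\frac{|z(s)|\,|z(t)|}{(p-1)\ell^p}\qquad\forall\,0<s<t<1.$$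 In particular, at any point $t\in(0,1)$ where $z$ is differentiable, $z'(t)\ge\dfrac{z(t)^2}{(p-1)\ell^p}$.
   Context: Proper means closed balls are compact. A geodesic is a map $\gamma:[0,1]\to X$ with $\mathsf d(\gamma_s,\gamma_t)=|s-t|\mathsf d(\gamma_0,\gamma_1)$; its length is $\ell(\gamma)=\mathsf d(\gamma_0,\gamma_1)$; $X$ is geodesic if any two points are joined by a geodesic. For $c=\mathsf d^p/p$, the $c$-transform is $\psi^c(x)=\inf_{y}\big(\mathsf d(x,y)^p/p-\psi(y)\big)$. A Kantorovich potential is a function $\varphi:X\to\mathbb R\cup\{-\infty\}$, not identically $-\infty$, with $\varphi=\psi^c$ for some $\psi:X\to\mathbb R\cup\{\pm\infty\}$. $G_\varphi$ is the set of $(\varphi,p)$-Kantorovich geodesics: geodesics $\gamma$ with $\varphi(\gamma_0)+\varphi^c(\gamma_1)=\mathsf d(\gamma_0,\gamma_1)^p/p$. Hopf–Lax transform: for $t>0$, $Q_tf(x)=\inf_{y\in X}\big(\frac{\mathsf d(x,y)^p}{pt^{p-1}}+f(y)\big)$, and $Q_0f=f$. For $t\in[0,1]$: $\varphi_t=-Q_t(-\varphi)$ and $\bar\varphi_t=Q_{1-t}(-\varphi^c)$. $D^+_f(x,t)$ (resp. $D^-_f(x,t)$) is the supremum of $\limsup_n\mathsf d(x,y_n)$ (resp. infimum of $\liminf_n\mathsf d(x,y_n)$) over all minimizing sequences $(y_n)$ in the definition of $Q_tf(x)$. Speeds, for $(x,t)\in X\times(0,1)$: $\ell^\pm_t(x)=D^\pm_{-\varphi}(x,t)/t$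 and $\bar\ell^\pm_t(x)=D^\pm_{-\varphi^c}(x,1-t)/(1-t)$. $D_\ell=\{(x,t):\ell_t^+(x)=\ell_t^-(x)\}$, $D_{\bar\ell}$ similarly with $\bar\ell$; there $\ell_t(x)$, $\bar\ell_t(x)$ denote the common values, and $D_\ell(x)=\{t:(x,t)\in D_\ell\}$, etc. (cocountable subsets of $(0,1)$). Derivatives $\partial_\tau\ell_\tau^p(x)$, $\partial_\tau\bar\ell^p_\tau(x)$ are limits of difference quotients taken along $\tau\in D_\ell(x)$, resp. $\tau\in D_{\bar\ell}(x)$. The functions $\tau\mapsto\varphi_\tau(x)$, $\tau\mapsto\bar\varphi_\tau(x)$ are locally semi-convex or semi-concave on $(0,1)$; such a function $f$ is called twice differentiable at $\tau_0$ with second derivative $\Delta\in\mathbb R$ if $f$ is differentiable at $\tau_0$ and $f(\tau_0+\varepsilon)=f(\tau_0)+f'(\tau_0)\varepsilon+\Delta\varepsilon^2/2+o(\varepsilon^2)$ as $\varepsilon\to0$ (equivalently, the derivative $f'$, defined on the set of differentiability points of $f$, has derivative $\Delta$ at $\tau_0$). *)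

theory Defs
  imports "HOL-Analysis.Analysis" "HOL-Library.Landau_Symbols"
begin

text \<open>
  The metric space is the whole type \<open>'a\<close>. Curves \<open>[0,1] \<rightarrow> X\<close> are functions
  on \<open>real\<close> of which only the values on \<open>{0..1}\<close> matter.
\<close>

definition is_geodesic :: "(real \<Rightarrow> 'a::metric_space) \<Rightarrow> bool" where
  "is_geodesic \<gamma> \<longleftrightarrow>
    (\<forall>s\<in>{0..1}. \<forall>t\<in>{0..1}. dist (\<gamma> s) (\<gamma> t) = \<bar>s - t\<bar> * dist (\<gamma> 0) (\<gamma> 1))"

definition geodesic_length :: "(real \<Rightarrow> 'a::metric_space) \<Rightarrow> real" where
  "geodesic_length \<gamma> = dist (\<gamma> 0) (\<gamma> 1)"

definition c_transform :: "real \<Rightarrow> ('a::metric_space \<Rightarrow> ereal) \<Rightarrow> 'a \<Rightarrow> ereal" where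
  "c_transform p \<psi> x = (INF y. ereal (dist x y powr p / p) - \<psi> y)"

definition kantorovich_potential :: "real \<Rightarrow> ('a::metric_space \<Rightarrow> ereal) \<Rightarrow> bool" where
  "kantorovich_potential p \<phi> \<longleftrightarrow>
    (\<forall>x. \<phi> x \<noteq> \<infinity>) \<and> (\<exists>x. \<phi> x \<noteq> -\<infinity>) \<and> (\<exists>\<psi>. \<phi> = c_transform p \<psi>)"

definition kantorovich_geodesics ::
  "real \<Rightarrow> ('a::metric_space \<Rightarrow> ereal) \<Rightarrow> (real \<Rightarrow> 'a) set" where
  "kantorovich_geodesics p \<phi> =
    {\<gamma>. is_geodesic \<gamma> \<and>
        \<phi> (\<gamma> 0) + c_transform p \<phi> (\<gamma> 1) = ereal (dist (\<gamma> 0) (\<gamma> 1) powr p / p)}"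

definition hl_cost ::
  "real \<Rightarrow> real \<Rightarrow> ('a::metric_space \<Rightarrow> ereal) \<Rightarrow> 'a \<Rightarrow> 'a \<Rightarrow> ereal" where
  "hl_cost p t f x y = ereal (dist x y powr p / (p * t powr (p - 1))) + f y"

text \<open>Only times \<open>t \<ge> 0\<close> are meaningful.\<close>

definition hopf_lax :: "real \<Rightarrow> real \<Rightarrow> ('a::metric_space \<Rightarrow> ereal) \<Rightarrow> 'a \<Rightarrow> ereal" where
  "hopf_lax p t f x = (if t = 0 then f x else (INF y. hl_cost p t f x y))"

definition minimizing_seqs ::
  "real \<Rightarrow> ('a::metric_space \<Rightarrow> ereal) \<Rightarrow> 'a \<Rightarrow> real \<Rightarrow> (nat \<Rightarrow> 'a) set" where
  "minimizing_seqs p f x t = {y. (\<lambda>n. hl_cost p t f x (y n)) \<longlonglongrightarrow> hopf_lax p t f x}"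

definition D_plus :: "real \<Rightarrow> ('a::metric_space \<Rightarrow> ereal) \<Rightarrow> 'a \<Rightarrow> real \<Rightarrow> ereal" where
  "D_plus p f x t = (SUP y\<in>minimizing_seqs p f x t. limsup (\<lambda>n. ereal (dist x (y n))))"

definition D_minus :: "real \<Rightarrow> ('a::metric_space \<Rightarrow> ereal) \<Rightarrow> 'a \<Rightarrow> real \<Rightarrow> ereal" where
  "D_minus p f x t = (INF y\<in>minimizing_seqs p f x t. liminf (\<lambda>n. ereal (dist x (y n))))"

text \<open>
  If \<open>\<phi>\<close> is a real-valued Kantorovich potential, then both \<open>\<phi>\<close> and its transform are
  bounded above by a function \<open>d(\<cdot>, z)\<^sup>p / p + C\<close> and the transform is finite somewhere.
  So for times in \<open>(0,1)\<close> the two interpolations below are finite and minimizing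
  sequences are bounded: \<open>real_of_ereal\<close> is only ever applied to finite values, in the
  interpolations as well as in the speeds.
\<close>

definition interp :: "real \<Rightarrow> ('a::metric_space \<Rightarrow> ereal) \<Rightarrow> real \<Rightarrow> 'a \<Rightarrow> real" where
  "interp p \<phi> t x = real_of_ereal (- hopf_lax p t (\<lambda>y. - \<phi> y) x)"

definition interp_bar :: "real \<Rightarrow> ('a::metric_space \<Rightarrow> ereal) \<Rightarrow> real \<Rightarrow> 'a \<Rightarrow> real" where
  "interp_bar p \<phi> t x = real_of_ereal (hopf_lax p (1 - t) (\<lambda>y. - c_transform p \<phi> y) x)"

definition ell_plus :: "real \<Rightarrow> ('a::metric_space \<Rightarrow> ereal) \<Rightarrow> real \<Rightarrow> 'a \<Rightarrow> ereal" where
  "ell_plus p \<phi> t x = D_plus p (\<lambda>y. - \<phi> y) x t / ereal t"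

definition ell_minus :: "real \<Rightarrow> ('a::metric_space \<Rightarrow> ereal) \<Rightarrow> real \<Rightarrow> 'a \<Rightarrow> ereal" where
  "ell_minus p \<phi> t x = D_minus p (\<lambda>y. - \<phi> y) x t / ereal t"

definition ell_bar_plus :: "real \<Rightarrow> ('a::metric_space \<Rightarrow> ereal) \<Rightarrow> real \<Rightarrow> 'a \<Rightarrow> ereal" where
  "ell_bar_plus p \<phi> t x = D_plus p (\<lambda>y. - c_transform p \<phi> y) x (1 - t) / ereal (1 - t)"

definition ell_bar_minus :: "real \<Rightarrow> ('a::metric_space \<Rightarrow> ereal) \<Rightarrow> real \<Rightarrow> 'a \<Rightarrow> ereal" where
  "ell_bar_minus p \<phi> t x = D_minus p (\<lambda>y. - c_transform p \<phi> y) x (1 - t) / ereal (1 - t)"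

definition D_ell :: "real \<Rightarrow> ('a::metric_space \<Rightarrow> ereal) \<Rightarrow> 'a \<Rightarrow> real set" where
  "D_ell p \<phi> x = {t\<in>{0<..<1}. ell_plus p \<phi> t x = ell_minus p \<phi> t x}"

definition D_ell_bar :: "real \<Rightarrow> ('a::metric_space \<Rightarrow> ereal) \<Rightarrow> 'a \<Rightarrow> real set" where
  "D_ell_bar p \<phi> x = {t\<in>{0<..<1}. ell_bar_plus p \<phi> t x = ell_bar_minus p \<phi> t x}"

text \<open>The common values; meaningful only for \<open>t\<close> in \<open>D_ell\<close>, respectively \<open>D_ell_bar\<close>.\<close>

definition ell :: "real \<Rightarrow> ('a::metric_space \<Rightarrow> ereal) \<Rightarrow> real \<Rightarrow> 'a \<Rightarrow> real" where
  "ell p \<phi> t x = real_of_ereal (ell_plus p \<phi> t x)"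

definition ell_bar :: "real \<Rightarrow> ('a::metric_space \<Rightarrow> ereal) \<Rightarrow> real \<Rightarrow> 'a \<Rightarrow> real" where
  "ell_bar p \<phi> t x = real_of_ereal (ell_bar_plus p \<phi> t x)"

text \<open>
  Twice differentiability is the existence of a second-order Peano expansion; \<open>f\<close> need not
  be differentiable at points other than \<open>t\<close>.
\<close>

definition has_second_derivative :: "(real \<Rightarrow> real) \<Rightarrow> real \<Rightarrow> real \<Rightarrow> bool" where
  "has_second_derivative f \<Delta> t \<longleftrightarrow>
    f differentiable (at t) \<and>
    (\<lambda>\<epsilon>. f (t + \<epsilon>) - (f t + deriv f t * \<epsilon> + \<Delta> * \<epsilon>\<^sup>2 / 2)) \<in> o[at 0](\<lambda>\<epsilon>. \<epsilon>\<^sup>2)"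

definition twice_differentiable_at :: "(real \<Rightarrow> real) \<Rightarrow> real \<Rightarrow> bool" where
  "twice_differentiable_at f t \<longleftrightarrow> (\<exists>\<Delta>. has_second_derivative f \<Delta> t)"

text \<open>Meaningful only where \<open>f\<close> is twice differentiable (the value is then unique).\<close>

definition second_deriv :: "(real \<Rightarrow> real) \<Rightarrow> real \<Rightarrow> real" where
  "second_deriv f t = (THE \<Delta>. has_second_derivative f \<Delta> t)"

end

theory Submission
  imports Defs "HOL-Real_Asymp.Real_Asymp"
begin

text \<open>
The forward interpolation \<open>\<phi>\<^sub>\<tau>(x)\<close> is a supremum of \<open>\<phi> y\<close> minus the action of moving from \<open>y\<close> to \<open>x\<close>
in time \<open>\<tau>\<close>. The action \<open>r\<^sup>p / (p u\<^sup>p\<^sup>-\<^sup>1)\<close> is jointly subadditive in time and distance, and everything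
rests on the resulting comparison between two points of the geodesic: for \<open>s < t\<close> and small shifts
\<open>\<delta>\<close>, \<open>\<epsilon>\<close>, the interpolation at \<open>(\<gamma> t, t + \<epsilon>)\<close> is at least the one at \<open>(\<gamma> s, s + \<delta>)\<close> minus the action
of going from \<open>\<gamma> s\<close> to \<open>\<gamma> t\<close> in time \<open>t - s + \<epsilon> - \<delta>\<close>. There is equality for \<open>\<delta> = \<epsilon> = 0\<close>, and the
first-order terms agree as well: at \<open>\<gamma> t\<close> the map \<open>\<tau> \<mapsto> \<phi>\<^sub>\<tau>\<close> is squeezed between two smooth functions
and has derivative \<open>(p - 1) \<ell>\<^sup>p / p\<close> (\<open>interp_deriv\<close>).

Equal shifts \<open>\<delta> = \<epsilon>\<close> cost nothing, so the second-order difference quotients of the interpolation are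
monotone along \<open>\<gamma>\<close>. At almost every time \<open>t\<close> they converge, up to the factor \<open>1/2\<close>, to \<open>z t\<close>; since
\<open>z\<close> is continuous, they then do so at every time (\<open>second_derivative_everywhere\<close>). Shifts \<open>\<epsilon> = a \<eta>\<close>, \<open>\<delta> = b \<eta>\<close> yield, at
order \<open>\<eta>\<^sup>2\<close>, with \<open>K = (p - 1) \<ell>\<^sup>p\<close>,
\<open>0 \<le> z t a\<^sup>2 - z s b\<^sup>2 + K (a - b)\<^sup>2 / (t - s)\<close> for all \<open>a\<close>, \<open>b\<close>
(\<open>second_derivative_form\<close>). The determinant of this form gives the difference inequality when
\<open>z s\<close> and \<open>z t\<close> have the same sign; when they do not, it follows from the a priori bounds that the
form implies on all of \<open>(0, 1)\<close> (\<open>riccati_chord_bound\<close>).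

The speed enters through minimizing sequences: the limiting distance \<open>L\<close> of such a sequence for
\<open>(x, \<tau>)\<close> makes \<open>(p - 1) (L/\<tau>)\<^sup>p / p\<close> a subgradient of \<open>\<tau> \<mapsto> \<phi>\<^sub>\<tau>(x)\<close> up to a quadratic error. At
\<open>(\<gamma> t, t)\<close> this function is differentiable, so \<open>L\<close> is unique and both extreme speeds equal \<open>\<ell>\<close>. Around
\<open>t\<close>, a subgradient selection of a semiconvex function with a second-order expansion is
differentiable (\<open>subgradient_has_derivative\<close>), whence the derivative of the speed.

The backward interpolation is the negative of the forward interpolation of \<open>\<phi>\<^sup>c\<close> along the reversed
geodesic in reversed time, so it needs no separate argument.
\<close>

section \<open>The action of a motion at constant speed\<close>

text \<open>
The kernel of the Hopf--Lax formula: the least \<open>p\<close>-action of a motion over distance \<open>r\<close> in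
time \<open>u\<close>. It is the perspective \<open>u (r/u)\<^sup>p / p\<close> of the convex function \<open>r\<^sup>p / p\<close>, which is where
its joint convexity comes from.
\<close>
definition action :: "real \<Rightarrow> real \<Rightarrow> real \<Rightarrow> real" where
  "action p u r = r powr p / (p * u powr (p - 1))"

lemma action_antimono:
  assumes "p > 1" "0 < u" "u \<le> v"
  shows "action p v r \<le> action p u r"
  unfolding action_def using assms
  by (intro divide_left_mono mult_left_mono powr_mono2 mult_pos_pos) auto

lemma action_mono:
  assumes "p > 1" "0 < u" "0 \<le> r" "r \<le> s"
  shows "action p u r \<le> action p u s"
  unfolding action_def using assms
  by (intro divide_right_mono powr_mono2) auto

lemma action_scale:
  assumes "p > 1" "0 < u" "0 \<le> r"
  shows "action p u (u * r) = u * (r powr p / p)"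
proof -
  have "u powr p = u * u powr (p - 1)"
    using assms by (simp add: powr_diff)
  then show ?thesis
    unfolding action_def using assms by (simp add: powr_mult)
qed

lemma action_eq_perspective:
  assumes "p > 1" "0 < u" "0 \<le> r"
  shows "action p u r = u * ((r / u) powr p / p)"
  using action_scale[of p u "r / u"] assms by simp

text \<open>
Two motions in succession cost at least as much as one motion at constant speed over the total
distance. Since \<open>action\<close> is positively homogeneous of degree one in \<open>(u, r)\<close>, this is joint
convexity, that is, convexity of \<open>x\<^sup>p\<close> at the two speeds with weights \<open>u/(u+v)\<close> and \<open>v/(u+v)\<close>.
\<close>
lemma action_subadditive:
  assumes p: "p > 1" and u: "0 < u" and v: "0 < v" and a: "0 \<le> a" and b: "0 \<le> b"
  shows "action p (u + v) (a + b) \<le> action p u a + action p v b"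
proof (cases "a = 0 \<or> b = 0")
  case True
  have "0 \<le> action p u a" "0 \<le> action p v b"
    unfolding action_def using assms by auto
  moreover have "action p (u + v) (a + b) \<le> action p u a" if "b = 0"
    using that action_antimono[of p u "u + v" a] assms by simp
  moreover have "action p (u + v) (a + b) \<le> action p v b" if "a = 0"
    using that action_antimono[of p v "u + v" b] assms by simp
  ultimately show ?thesis using True by linarith
next
  case False
  then have a': "a > 0" and b': "b > 0" using a b by auto
  define w where "w = u + v"
  have w: "w > 0" using u v by (simp add: w_def)
  have sum1: "u / w + v / w = 1" using w by (simp add: w_def add_divide_distrib[symmetric])
  have "((u / w) *\<^sub>R (a / u) + (v / w) *\<^sub>R (b / v)) powr p
      \<le> (u / w) * (a / u) powr p + (v / w) * (b / v) powr p"
  proof -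
    have "\<And>x y u v. \<lbrakk>x \<in> {0<..}; y \<in> {0<..}; 0 \<le> u; 0 \<le> v; u + v = 1\<rbrakk> \<Longrightarrow>
        (u *\<^sub>R x + v *\<^sub>R y) powr p \<le> u * x powr p + v * y powr p"
      using powr_convex[of p] p unfolding convex_on_def by auto
    from this[of "a / u" "b / v" "u / w" "v / w"] show ?thesis
      using u v w a' b' sum1 by simp
  qed
  also have "(u / w) *\<^sub>R (a / u) + (v / w) *\<^sub>R (b / v) = (a + b) / w"
    using u v by (simp add: add_divide_distrib)
  finally have "w * ((a + b) / w) powr p \<le> u * (a / u) powr p + v * (b / v) powr p"
    using w by (simp add: field_simps)
  then have "w * (((a + b) / w) powr p / p) \<le> u * ((a / u) powr p / p) + v * ((b / v) powr p / p)"
    using p by (simp add: field_simps)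
  then show ?thesis
    using action_eq_perspective[OF p u a] action_eq_perspective[OF p v b]
      action_eq_perspective[OF p w, of "a + b"] a b by (simp add: w_def)
qed

lemma action_deriv:
  assumes "p > 1" "0 < u"
  shows "((\<lambda>u. action p u r) has_real_derivative (- ((p - 1) * (r powr p / p) / u powr p))) (at u)"
proof -
  have eq: "action p v r = (r powr p / p) * v powr (1 - p)" for v
    unfolding action_def by (simp add: powr_diff)
  have "((\<lambda>v. (r powr p / p) * v powr (1 - p)) has_real_derivative
        (r powr p / p) * ((1 - p) * u powr (1 - p - 1))) (at u)"
    using assms by (auto intro!: derivative_eq_intros)
  moreover have "(r powr p / p) * ((1 - p) * u powr (1 - p - 1)) = - ((p - 1) * (r powr p / p) / u powr p)"
    by (simp add: powr_minus divide_inverse algebra_simps)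
  ultimately show ?thesis by (simp add: eq)
qed

lemma tendsto_action:
  assumes "p > 1" "(d \<longlongrightarrow> L) F" "\<And>n. d n \<ge> 0"
  shows "((\<lambda>n. action p u (d n)) \<longlongrightarrow> action p u L) F"
  unfolding action_def divide_inverse using assms
  by (intro tendsto_mult tendsto_powr' tendsto_const) auto

text \<open>
The binomial expansion of \<open>(1 + x) powr (1 - p)\<close>: all second-order information about the action
in its time argument comes from it.
\<close>
lemma powr_second_order:
  fixes p :: real
  shows "((\<lambda>x. ((1 + x) powr (1 - p) - 1 + (p - 1) * x) / x\<^sup>2) \<longlongrightarrow> p * (p - 1) / 2) (at 0)"
proof -
  have "((\<lambda>x. ((1 + x) powr (1 - p) - 1 + (p - 1) * x) / x\<^sup>2) \<longlongrightarrow> - (p * (1 - p) / 2)) (at 0)"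
    by real_asymp
  moreover have "- (p * (1 - p) / 2) = p * (p - 1) / 2" by (simp add: field_simps)
  ultimately show ?thesis by simp
qed

lemma action_factor:
  assumes "p > 1" "0 < h" "0 \<le> l" "- h < x"
  shows "action p (h + x) (h * l) = h * (l powr p / p) * (1 + x / h) powr (1 - p)"
proof -
  have "h + x = h * (1 + x / h)" using assms by (simp add: field_simps)
  moreover have "0 < 1 + x / h" using assms by (simp add: field_simps)
  ultimately have "(h + x) powr (p - 1) = h powr (p - 1) * (1 + x / h) powr (p - 1)"
    using assms by (simp add: powr_mult)
  moreover have "(1 + x / h) powr (1 - p) = inverse ((1 + x / h) powr (p - 1))"
    using powr_minus[of "1 + x / h" "p - 1"] by simp
  moreover have "h powr p = h * h powr (p - 1)"
    using assms by (simp add: powr_diff)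
  ultimately show ?thesis
    unfolding action_def using assms by (simp add: powr_mult field_simps)
qed

text \<open>
The motion over distance \<open>h l\<close> has speed \<open>l\<close> when it takes the time \<open>h\<close>. The limit is the
second-order excess of its action when it takes \<open>c x\<close> longer; this is quadratic in \<open>c\<close> and blows
up as \<open>h\<close> tends to \<open>0\<close>, and so produces the factor \<open>1/(t - s)\<close> in the quadratic form of
\<open>second_derivative_form\<close>.
\<close>
lemma action_second_order:
  assumes "p > 1" and h: "0 < h" and "0 \<le> l"
  shows "((\<lambda>x. (action p (h + c * x) (h * l) - h * (l powr p / p) + (p - 1) * (l powr p / p) * (c * x)) / x\<^sup>2)
           \<longlongrightarrow> (p - 1) * l powr p * c\<^sup>2 / (2 * h)) (at 0)"
proof (cases "c = 0")
  case True
  then show ?thesis using assms action_scale[of p h l] by simp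
next
  case False
  have lim: "((\<lambda>x. c / h * x) \<longlongrightarrow> 0) (at 0)"
    by (rule tendsto_mult_right_zero) simp
  have filt: "filterlim (\<lambda>x. c / h * x) (at 0) (at 0)"
    using False assms lim by (auto simp: filterlim_at eventually_at intro!: exI[of _ 1])
  have "((\<lambda>x. (l powr p / p) * (c\<^sup>2 / h) * (((1 + c / h * x) powr (1 - p) - 1 + (p - 1) * (c / h * x)) / (c / h * x)\<^sup>2))
           \<longlongrightarrow> (l powr p / p) * (c\<^sup>2 / h) * (p * (p - 1) / 2)) (at 0)"
    by (intro tendsto_intros filterlim_compose[OF powr_second_order filt])
  also have "(l powr p / p) * (c\<^sup>2 / h) * (p * (p - 1) / 2) = (p - 1) * l powr p * c\<^sup>2 / (2 * h)"
    using assms by (simp add: field_simps)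
  finally show ?thesis
  proof (rule Lim_transform_eventually)
    have "eventually (\<lambda>x. \<bar>x\<bar> < h / \<bar>c\<bar>) (at 0)"
      using assms False by (auto simp: eventually_at intro!: exI[of _ "h / \<bar>c\<bar>"])
    then show "\<forall>\<^sub>F x in at 0. l powr p / p * (c\<^sup>2 / h) * (((1 + c / h * x) powr (1 - p) - 1 + (p - 1) * (c / h * x)) / (c / h * x)\<^sup>2)
       = (action p (h + c * x) (h * l) - h * (l powr p / p) + (p - 1) * (l powr p / p) * (c * x)) / x\<^sup>2"
      using eventually_neq_at_within[of 0 0 UNIV]
    proof eventually_elim
      case (elim x)
      define y where "y = c / h * x"
      define L where "L = l powr p / p"
      define P where "P = (1 + y) powr (1 - p)"
      have cx: "c * x = h * y" using h by (simp add: y_def)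
      have x2: "x\<^sup>2 = (h\<^sup>2 / c\<^sup>2) * y\<^sup>2"
        using h False by (simp add: y_def power_mult_distrib power_divide)
      have "\<bar>c * x\<bar> < h" using elim False by (simp add: abs_mult field_simps)
      then have "action p (h + c * x) (h * l) = h * L * (1 + c * x / h) powr (1 - p)"
        unfolding L_def by (intro action_factor assms) auto
      then have act: "action p (h + h * y) (h * l) = h * L * P"
        using h by (simp add: cx P_def)
      have "(h * L * P - h * L + (p - 1) * L * (h * y)) / ((h\<^sup>2 / c\<^sup>2) * y\<^sup>2)
          = h * L * (P - 1 + (p - 1) * y) / ((h\<^sup>2 / c\<^sup>2) * y\<^sup>2)"
        by (simp add: algebra_simps)
      also have "\<dots> = L * (c\<^sup>2 / h) * ((P - 1 + (p - 1) * y) / y\<^sup>2)"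
        using h False by (simp add: power2_eq_square)
      finally show ?case
        unfolding x2 cx act y_def[symmetric] P_def[symmetric] L_def[symmetric] by (rule sym)
    qed
  qed
qed

text \<open>
A one-sided Taylor estimate that is uniform in \<open>\<tau>\<close> and \<open>l\<close>: up to a quadratic error, the gain in
action from having the time \<open>k\<close> more is linear in \<open>k\<close>, with slope
\<open>(p - 1) l\<^sup>p / p\<close>.
\<close>
lemma action_subgradient:
  assumes p: "p > 1"
  shows "\<exists>\<rho>>0. \<forall>\<tau> k l. 0 < \<tau> \<longrightarrow> 0 \<le> l \<longrightarrow> \<bar>k\<bar> \<le> \<rho> * \<tau> \<longrightarrow>
    (p - 1) * (l powr p / p) * k - (p * (p - 1) / 2 + 1) * (l powr p / p) * k\<^sup>2 / \<tau>
      \<le> action p \<tau> (\<tau> * l) - action p (\<tau> + k) (\<tau> * l)"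
proof -
  have "eventually (\<lambda>x. ((1 + x) powr (1 - p) - 1 + (p - 1) * x) / x\<^sup>2 < p * (p - 1) / 2 + 1) (at 0)"
    by (rule order_tendstoD[OF powr_second_order]) simp
  then obtain d where d: "d > 0"
    and *: "\<And>x. x \<noteq> 0 \<Longrightarrow> \<bar>x\<bar> < d \<Longrightarrow> ((1 + x) powr (1 - p) - 1 + (p - 1) * x) / x\<^sup>2 < p * (p - 1) / 2 + 1"
    by (auto simp: eventually_at)
  have **: "(1 + x) powr (1 - p) \<le> 1 - (p - 1) * x + (p * (p - 1) / 2 + 1) * x\<^sup>2" if "\<bar>x\<bar> < d" for x
  proof (cases "x = 0")
    case False
    then have "x\<^sup>2 > 0" by simp
    with *[OF False that] have "(1 + x) powr (1 - p) - 1 + (p - 1) * x < (p * (p - 1) / 2 + 1) * x\<^sup>2"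
      by (simp only: pos_divide_less_eq)
    then show ?thesis by linarith
  qed simp
  show ?thesis
  proof (intro exI[of _ "min (d / 2) (1 / 2)"] conjI allI impI)
    show "min (d / 2) (1 / 2) > 0" using d by simp
  next
    fix \<tau> k l :: real
    assume \<tau>: "0 < \<tau>" and l: "0 \<le> l" and k: "\<bar>k\<bar> \<le> min (d / 2) (1 / 2) * \<tau>"
    define x where "x = k / \<tau>"
    have kx: "k = \<tau> * x" using \<tau> by (simp add: x_def)
    have "\<bar>x\<bar> \<le> min (d / 2) (1 / 2)"
      using k \<tau> by (simp only: x_def abs_divide abs_of_pos pos_divide_le_eq)
    then have xd: "\<bar>x\<bar> < d" and x1: "- 1 < x" using d by linarith+
    have "\<tau> * - 1 < \<tau> * x" using \<tau> x1 by (intro mult_strict_left_mono)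
    then have "- \<tau> < k" by (simp add: kx)
    then have A: "action p (\<tau> + k) (\<tau> * l) = \<tau> * (l powr p / p) * (1 + x) powr (1 - p)"
      unfolding x_def using p \<tau> l by (intro action_factor)
    have "\<tau> * (l powr p / p) * (1 + x) powr (1 - p)
       \<le> \<tau> * (l powr p / p) * (1 - (p - 1) * x + (p * (p - 1) / 2 + 1) * x\<^sup>2)"
      using \<tau> p by (intro mult_left_mono[OF **[OF xd]]) simp
    also have "\<dots> = \<tau> * (l powr p / p) - (p - 1) * (l powr p / p) * k + (p * (p - 1) / 2 + 1) * (l powr p / p) * k\<^sup>2 / \<tau>"
      unfolding kx using \<tau> p by (simp add: field_simps power2_eq_square)
    finally show "(p - 1) * (l powr p / p) * k - (p * (p - 1) / 2 + 1) * (l powr p / p) * k\<^sup>2 / \<tau>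
      \<le> action p \<tau> (\<tau> * l) - action p (\<tau> + k) (\<tau> * l)"
      unfolding A action_scale[OF p \<tau> l] by linarith
  qed
qed

section \<open>Second-order expansions and subgradients\<close>

text \<open>
The expansion as the limit of a quotient, with the first derivative supplied explicitly: in this
form second derivatives can be compared and rescaled by the limit calculus.
\<close>
lemma has_second_derivative_iff:
  assumes f: "(f has_real_derivative a) (at t)"
  shows "has_second_derivative f \<Delta> t \<longleftrightarrow>
    ((\<lambda>\<epsilon>. (f (t + \<epsilon>) - f t - a * \<epsilon>) / \<epsilon>\<^sup>2) \<longlongrightarrow> \<Delta> / 2) (at 0)"
proof -
  have diff: "f differentiable (at t)" and d: "deriv f t = a"
    using f by (auto simp: real_differentiable_def DERIV_imp_deriv)
  have ev: "eventually (\<lambda>\<epsilon>::real. \<epsilon>\<^sup>2 \<noteq> 0) (at 0)"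
    using eventually_neq_at_within by (rule eventually_mono) simp
  have "has_second_derivative f \<Delta> t \<longleftrightarrow>
     ((\<lambda>\<epsilon>. (f (t + \<epsilon>) - (f t + a * \<epsilon> + \<Delta> * \<epsilon>\<^sup>2 / 2)) / \<epsilon>\<^sup>2) \<longlongrightarrow> 0) (at 0)"
    unfolding has_second_derivative_def d using diff smalloI_tendsto[OF _ ev] by (auto dest: smalloD_tendsto)
  also have "\<dots> \<longleftrightarrow> ((\<lambda>\<epsilon>. (f (t + \<epsilon>) - f t - a * \<epsilon>) / \<epsilon>\<^sup>2 - \<Delta> / 2) \<longlongrightarrow> 0) (at 0)"
  proof (rule filterlim_cong[OF refl refl])
    show "\<forall>\<^sub>F \<epsilon> in at 0. (f (t + \<epsilon>) - (f t + a * \<epsilon> + \<Delta> * \<epsilon>\<^sup>2 / 2)) / \<epsilon>\<^sup>2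
        = (f (t + \<epsilon>) - f t - a * \<epsilon>) / \<epsilon>\<^sup>2 - \<Delta> / 2"
      using ev by (rule eventually_mono) (simp add: field_simps)
  qed
  also have "\<dots> \<longleftrightarrow> ((\<lambda>\<epsilon>. (f (t + \<epsilon>) - f t - a * \<epsilon>) / \<epsilon>\<^sup>2) \<longlongrightarrow> \<Delta> / 2) (at 0)"
    by (rule LIM_zero_iff)
  finally show ?thesis .
qed

lemma has_second_derivative_unique:
  assumes "has_second_derivative f \<Delta> t" "has_second_derivative f \<Delta>' t"
  shows "\<Delta> = \<Delta>'"
proof -
  from assms obtain a where a: "(f has_real_derivative a) (at t)"
    by (auto simp: has_second_derivative_def real_differentiable_def)
  have "\<Delta> / 2 = \<Delta>' / 2"
    using assms unfolding has_second_derivative_iff[OF a]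
    by (intro tendsto_unique[OF _ _ _]) auto
  then show ?thesis by simp
qed

lemma second_deriv_eq:
  "has_second_derivative f \<Delta> t \<Longrightarrow> second_deriv f t = \<Delta>"
  unfolding second_deriv_def using has_second_derivative_unique by blast

lemma has_second_derivative_second_deriv:
  "twice_differentiable_at f t \<Longrightarrow> has_second_derivative f (second_deriv f t) t"
  unfolding twice_differentiable_at_def using second_deriv_eq by blast

lemma has_second_derivative_reflect:
  assumes "has_second_derivative f \<Delta> (1 - t)"
  shows "has_second_derivative (\<lambda>\<tau>. - f (1 - \<tau>)) (- \<Delta>) t"
proof -
  from assms obtain a where a: "(f has_real_derivative a) (at (1 - t))"
    by (auto simp: has_second_derivative_def real_differentiable_def)
  have "((\<lambda>\<tau>. 1 - \<tau>) has_real_derivative - 1) (at t)"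
    by (auto intro!: derivative_eq_intros)
  from DERIV_minus[OF DERIV_chain2[of f a "\<lambda>\<tau>. 1 - \<tau>" t "- 1" UNIV, OF a this]]
  have d: "((\<lambda>\<tau>. - f (1 - \<tau>)) has_real_derivative a) (at t)"
    by simp
  have "((\<lambda>\<epsilon>. - ((f (1 - t + - \<epsilon>) - f (1 - t) - a * - \<epsilon>) / (- \<epsilon>)\<^sup>2)) \<longlongrightarrow> - (\<Delta> / 2)) (at 0)"
  proof (intro tendsto_minus filterlim_compose[OF assms[unfolded has_second_derivative_iff[OF a]]])
    show "filterlim uminus (at 0) (at (0::real))"
      using tendsto_minus[OF tendsto_ident_at, of "0::real" UNIV]
      by (auto simp: filterlim_at eventually_at intro!: exI[of _ 1])
  qed
  moreover have "(- f (1 - (t + \<epsilon>)) - - f (1 - t) - a * \<epsilon>) / \<epsilon>\<^sup>2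
      = - ((f (1 - t + - \<epsilon>) - f (1 - t) - a * - \<epsilon>) / (- \<epsilon>)\<^sup>2)" for \<epsilon>
    by (simp add: diff_diff_eq minus_divide_left)
  ultimately show ?thesis
    unfolding has_second_derivative_iff[OF d] by simp
qed

lemma has_real_derivative_squeeze:
  fixes f lo hi :: "real \<Rightarrow> real"
  assumes lo: "(lo has_real_derivative a) (at t)" and hi: "(hi has_real_derivative a) (at t)"
    and bounds: "eventually (\<lambda>\<tau>. lo \<tau> \<le> f \<tau> \<and> f \<tau> \<le> hi \<tau>) (nhds t)"
    and eq: "lo t = f t" "hi t = f t"
  shows "(f has_real_derivative a) (at t)"
proof -
  have "((\<lambda>\<tau>. \<bar>(lo \<tau> - lo t) / (\<tau> - t) - a\<bar> + \<bar>(hi \<tau> - hi t) / (\<tau> - t) - a\<bar>) \<longlongrightarrow> \<bar>a - a\<bar> + \<bar>a - a\<bar>) (at t)"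
    using lo hi unfolding has_field_derivative_iff by (intro tendsto_intros) auto
  then have lim: "((\<lambda>\<tau>. \<bar>(lo \<tau> - lo t) / (\<tau> - t) - a\<bar> + \<bar>(hi \<tau> - hi t) / (\<tau> - t) - a\<bar>) \<longlongrightarrow> 0) (at t)"
    by simp
  have "((\<lambda>\<tau>. (f \<tau> - f t) / (\<tau> - t) - a) \<longlongrightarrow> 0) (at t)"
  proof (rule Lim_null_comparison[OF _ lim])
    have "eventually (\<lambda>\<tau>. lo \<tau> \<le> f \<tau> \<and> f \<tau> \<le> hi \<tau>) (at t)"
      using bounds by (simp add: eventually_nhds_conv_at)
    then show "\<forall>\<^sub>F \<tau> in at t. norm ((f \<tau> - f t) / (\<tau> - t) - a)
        \<le> \<bar>(lo \<tau> - lo t) / (\<tau> - t) - a\<bar> + \<bar>(hi \<tau> - hi t) / (\<tau> - t) - a\<bar>"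
    proof eventually_elim
      case (elim \<tau>)
      have "(lo \<tau> - lo t) / (\<tau> - t) \<le> (f \<tau> - f t) / (\<tau> - t) \<and> (f \<tau> - f t) / (\<tau> - t) \<le> (hi \<tau> - hi t) / (\<tau> - t)
        \<or> (hi \<tau> - hi t) / (\<tau> - t) \<le> (f \<tau> - f t) / (\<tau> - t) \<and> (f \<tau> - f t) / (\<tau> - t) \<le> (lo \<tau> - lo t) / (\<tau> - t)"
        using elim eq by (cases "\<tau> \<ge> t") (simp_all add: divide_right_mono divide_right_mono_neg)
      then show ?case unfolding real_norm_def by linarith
    qed
  qed
  then show ?thesis
    unfolding has_field_derivative_iff by (simp add: LIM_zero_iff)
qed

text \<open>
For a semiconvex function, a second-order Peano expansion at \<open>t\<close> forces every selection \<open>m\<close> of its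
subgradients to be differentiable at \<open>t\<close>. Testing the subgradient inequality at \<open>\<tau> = t + h\<close> with
steps \<open>k = \<kappa>\<bar>h\<bar>\<close> and \<open>k = - \<kappa>\<bar>h\<bar>\<close> determines \<open>m \<tau> - m t - \<Delta> h\<close> up to \<open>O(\<kappa> h) + o(h)/\<kappa>\<close>; here \<open>\<kappa>\<close> may be
taken as small as desired before \<open>h\<close> is.
\<close>
lemma subgradient_has_derivative:
  assumes peano: "((\<lambda>h. (G (t + h) - G t - m t * h) / h\<^sup>2) \<longlongrightarrow> \<Delta> / 2) (at 0)"
    and \<delta>: "\<delta> > 0"
    and sub: "\<And>\<tau> k. \<tau> \<in> D \<Longrightarrow> \<bar>\<tau> - t\<bar> < \<delta> \<Longrightarrow> \<bar>k\<bar> < \<delta> \<Longrightarrow> m \<tau> * k - C * k\<^sup>2 \<le> G (\<tau> + k) - G \<tau>"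
  shows "(m has_real_derivative \<Delta>) (at t within D)"
  unfolding has_field_derivative_iff
proof (rule tendstoI)
  fix e :: real assume e: "e > 0"
  define B where "B = \<bar>\<Delta>\<bar> / 2 + \<bar>C\<bar> + 1"
  have B: "B > 0" by (simp add: B_def add_nonneg_pos)
  \<comment> \<open>The constants are chosen so that \<open>B \<kappa>\<close> and \<open>5 \<eta>/\<kappa>\<close>, the two contributions to the error
    relative to \<open>\<bar>h\<bar>\<close>, are at most \<open>e/4\<close> each.\<close>
  define \<kappa> where "\<kappa> = min 1 (e / (4 * B))"
  have \<kappa>: "\<kappa> > 0" "\<kappa> \<le> 1" using e B by (auto simp: \<kappa>_def)
  have B\<kappa>: "B * \<kappa> \<le> e / 4"
  proof -
    have "B * \<kappa> \<le> B * (e / (4 * B))" using B by (intro mult_left_mono) (auto simp: \<kappa>_def)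
    then show ?thesis using B by simp
  qed
  define \<eta> where "\<eta> = e * \<kappa> / 20"
  have \<eta>: "\<eta> > 0" using e \<kappa> by (simp add: \<eta>_def)
  define r where "r h = G (t + h) - G t - m t * h - \<Delta> * h\<^sup>2 / 2" for h
  from tendstoD[OF peano \<eta>] obtain d where d: "d > 0"
    and dd: "\<And>h. h \<noteq> 0 \<Longrightarrow> \<bar>h\<bar> < d \<Longrightarrow> \<bar>(G (t + h) - G t - m t * h) / h\<^sup>2 - \<Delta> / 2\<bar> < \<eta>"
    by (auto simp: eventually_at dist_real_def)
  have r: "\<bar>r h\<bar> \<le> \<eta> * h\<^sup>2" if "\<bar>h\<bar> < d" for h
  proof (cases "h = 0")
    case False
    have "r h = ((G (t + h) - G t - m t * h) / h\<^sup>2 - \<Delta> / 2) * h\<^sup>2"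
      using False by (simp add: r_def field_simps)
    then have "\<bar>r h\<bar> = \<bar>(G (t + h) - G t - m t * h) / h\<^sup>2 - \<Delta> / 2\<bar> * h\<^sup>2"
      by (simp add: abs_mult)
    also have "\<dots> \<le> \<eta> * h\<^sup>2" using dd[OF False that] by (intro mult_right_mono) auto
    finally show ?thesis .
  qed (simp add: r_def)
  define \<delta>' where "\<delta>' = min \<delta> (d / 2)"
  have \<delta>': "\<delta>' > 0" using \<delta> d by (simp add: \<delta>'_def)
  have main: "\<bar>(m \<tau> - m t) / (\<tau> - t) - \<Delta>\<bar> < e" if \<tau>: "\<tau> \<in> D" "\<tau> \<noteq> t" "\<bar>\<tau> - t\<bar> < \<delta>'" for \<tau>
  proof -
    define h where "h = \<tau> - t"
    have h: "h \<noteq> 0" "\<bar>h\<bar> < \<delta>" "\<bar>h\<bar> < d / 2" using \<tau> by (auto simp: h_def \<delta>'_def)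
    have one: "(m \<tau> - m t - \<Delta> * h) * k \<le> (B * \<kappa> + 5 * \<eta> / \<kappa>) * \<bar>h\<bar> * (\<kappa> * \<bar>h\<bar>)"
      if k: "\<bar>k\<bar> = \<kappa> * \<bar>h\<bar>" for k
    proof -
      have kh: "\<bar>k\<bar> \<le> \<bar>h\<bar>" using k \<kappa> by (simp add: mult_left_le_one_le)
      have k2: "k\<^sup>2 = \<kappa>\<^sup>2 * h\<^sup>2" using arg_cong[OF k, of "\<lambda>x. x\<^sup>2"] by (simp add: power_mult_distrib)
      have "m \<tau> * k - C * k\<^sup>2 \<le> G (\<tau> + k) - G \<tau>"
        using sub[of \<tau> k] \<tau> h kh by (simp add: h_def \<delta>'_def)
      also have "G (\<tau> + k) - G \<tau> = m t * k + \<Delta> * h * k + \<Delta> * k\<^sup>2 / 2 + (r (h + k) - r h)"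
        by (simp add: r_def h_def field_simps power2_eq_square)
      finally have 1: "(m \<tau> - m t - \<Delta> * h) * k \<le> (\<Delta> / 2 + C) * k\<^sup>2 + (r (h + k) - r h)"
        by (simp add: algebra_simps)
      have "(\<Delta> / 2 + C) * k\<^sup>2 \<le> B * k\<^sup>2"
        by (intro mult_right_mono) (auto simp: B_def)
      moreover have "r (h + k) - r h \<le> \<eta> * (h + k)\<^sup>2 + \<eta> * h\<^sup>2"
        using r[of "h + k"] r[of h] h kh by linarith
      moreover have "(h + k)\<^sup>2 \<le> 4 * h\<^sup>2"
      proof -
        have "\<bar>h + k\<bar> \<le> \<bar>2 * h\<bar>" using kh by linarith
        then have "(h + k)\<^sup>2 \<le> (2 * h)\<^sup>2" by (simp only: abs_le_square_iff)
        then show ?thesis by simp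
      qed
      then have "\<eta> * (h + k)\<^sup>2 \<le> \<eta> * (4 * h\<^sup>2)" using \<eta> by (intro mult_left_mono) auto
      ultimately have "(m \<tau> - m t - \<Delta> * h) * k \<le> B * k\<^sup>2 + 5 * \<eta> * h\<^sup>2"
        using 1 by linarith
      also have "\<dots> = (B * \<kappa> + 5 * \<eta> / \<kappa>) * \<bar>h\<bar> * (\<kappa> * \<bar>h\<bar>)"
      proof -
        have "(B * \<kappa> + 5 * \<eta> / \<kappa>) * \<bar>h\<bar> * (\<kappa> * \<bar>h\<bar>) = (B * \<kappa> + 5 * \<eta> / \<kappa>) * \<kappa> * (\<bar>h\<bar> * \<bar>h\<bar>)"
          by (simp only: mult_ac)
        also have "\<bar>h\<bar> * \<bar>h\<bar> = h\<^sup>2" by (simp add: power2_eq_square)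
        also have "(B * \<kappa> + 5 * \<eta> / \<kappa>) * \<kappa> = B * \<kappa>\<^sup>2 + 5 * \<eta>"
          using \<kappa> by (simp add: distrib_right power2_eq_square)
        finally show ?thesis unfolding k2 by (simp add: distrib_right)
      qed
      finally show ?thesis .
    qed
    have pos: "\<kappa> * \<bar>h\<bar> > 0" using \<kappa> h by simp
    have "(m \<tau> - m t - \<Delta> * h) * (\<kappa> * \<bar>h\<bar>) \<le> (B * \<kappa> + 5 * \<eta> / \<kappa>) * \<bar>h\<bar> * (\<kappa> * \<bar>h\<bar>)"
      and "- (m \<tau> - m t - \<Delta> * h) * (\<kappa> * \<bar>h\<bar>) \<le> (B * \<kappa> + 5 * \<eta> / \<kappa>) * \<bar>h\<bar> * (\<kappa> * \<bar>h\<bar>)"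
      using one[of "\<kappa> * \<bar>h\<bar>"] one[of "- (\<kappa> * \<bar>h\<bar>)"] pos
      by (simp_all only: abs_minus_cancel abs_of_pos mult_minus_left mult_minus_right)
    then have "\<bar>m \<tau> - m t - \<Delta> * h\<bar> \<le> (B * \<kappa> + 5 * \<eta> / \<kappa>) * \<bar>h\<bar>"
      using pos by (simp only: mult_le_cancel_right_pos abs_le_iff)
    also have "\<dots> < e * \<bar>h\<bar>"
    proof -
      have "B * \<kappa> + 5 * \<eta> / \<kappa> < e" using B\<kappa> \<kappa> e by (simp add: \<eta>_def)
      then show ?thesis using h by simp
    qed
    finally have "\<bar>m \<tau> - m t - \<Delta> * h\<bar> / \<bar>h\<bar> < e"
      using h by (simp add: pos_divide_less_eq)
    moreover have "(m \<tau> - m t) / (\<tau> - t) - \<Delta> = (m \<tau> - m t - \<Delta> * h) / h"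
      using h by (simp add: h_def field_simps)
    ultimately show ?thesis by (simp add: abs_divide)
  qed
  show "\<forall>\<^sub>F \<tau> in at t within D. dist ((m \<tau> - m t) / (\<tau> - t)) \<Delta> < e"
    unfolding eventually_at using \<delta>' main by (auto simp: dist_real_def)
qed

section \<open>Interpolation along a calibrated geodesic\<close>

text \<open>
The situation in a form that is symmetric between the two potentials. Passing from
\<open>(f, g, \<gamma>)\<close> to \<open>(g, f)\<close> with the geodesic reversed exchanges \<open>\<phi>\<^sub>t\<close> with the negative of the
backward interpolation at time \<open>1 - t\<close>, so whatever is proved here about \<open>f\<close> holds for both.
Values \<open>-\<infinity>\<close> are admitted because a \<open>c\<close>-transform can take them.
\<close>
locale calibrated_pair =
  fixes p :: real and f g :: "'a::metric_space \<Rightarrow> ereal" and \<gamma> :: "real \<Rightarrow> 'a"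
  assumes p: "p > 1"
    and geod: "is_geodesic \<gamma>"
    and f_less: "\<And>y. f y \<noteq> \<infinity>" and g_less: "\<And>y. g y \<noteq> \<infinity>"
    and dual: "\<And>y z. f y + g z \<le> ereal (dist y z powr p / p)"
    and calibrated: "f (\<gamma> 0) + g (\<gamma> 1) = ereal (dist (\<gamma> 0) (\<gamma> 1) powr p / p)"
begin

abbreviation len :: real where "len \<equiv> geodesic_length \<gamma>"

text \<open>
The action that the geodesic spends per unit of time.
\<close>
definition energy :: real where "energy = len powr p / p"

definition f0 :: real where "f0 = real_of_ereal (f (\<gamma> 0))"

definition g1 :: real where "g1 = real_of_ereal (g (\<gamma> 1))"

abbreviation F :: "real \<Rightarrow> 'a \<Rightarrow> real" where "F \<equiv> interp p f"

lemma len_nonneg: "0 \<le> len"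
  by (simp add: geodesic_length_def)

lemma ends: "f (\<gamma> 0) = ereal f0" "g (\<gamma> 1) = ereal g1" "f0 + g1 = energy"
proof -
  show f: "f (\<gamma> 0) = ereal f0"
    using calibrated f_less[of "\<gamma> 0"] g_less[of "\<gamma> 1"]
    by (cases "f (\<gamma> 0)"; cases "g (\<gamma> 1)") (auto simp: f0_def)
  show g: "g (\<gamma> 1) = ereal g1"
    using calibrated f_less[of "\<gamma> 0"] g_less[of "\<gamma> 1"]
    by (cases "f (\<gamma> 0)"; cases "g (\<gamma> 1)") (auto simp: g1_def)
  show "f0 + g1 = energy"
    using calibrated by (simp add: f g energy_def geodesic_length_def)
qed

lemma dist_geod:
  assumes "0 \<le> s" "s \<le> t" "t \<le> 1"
  shows "dist (\<gamma> t) (\<gamma> s) = (t - s) * len"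
proof -
  have "dist (\<gamma> t) (\<gamma> s) = \<bar>t - s\<bar> * dist (\<gamma> 0) (\<gamma> 1)"
    using geod assms unfolding is_geodesic_def by (meson atLeastAtMost_iff order_trans)
  then show ?thesis using assms by (simp add: geodesic_length_def)
qed

text \<open>
Every competitor for the forward interpolation at \<open>(x, \<tau>)\<close> lies below the competitor
\<open>\<gamma> 1\<close> for the backward one: this is duality tested on the two-step motion from \<open>y\<close> through \<open>x\<close>
to \<open>\<gamma> 1\<close>.
\<close>
lemma f_bound:
  assumes \<tau>: "0 < \<tau>" "\<tau> < 1" and f: "f y = ereal r"
  shows "r - action p \<tau> (dist x y) \<le> action p (1 - \<tau>) (dist x (\<gamma> 1)) - g1"
proof -
  have "ereal (r + g1) \<le> ereal (dist y (\<gamma> 1) powr p / p)"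
    using dual[of y "\<gamma> 1"] by (simp add: f ends)
  then have "r + g1 \<le> action p 1 (dist y (\<gamma> 1))"
    by (simp add: action_def)
  also have "\<dots> \<le> action p 1 (dist x y + dist x (\<gamma> 1))"
    by (intro action_mono p) (auto simp: dist_triangle3)
  also have "\<dots> \<le> action p \<tau> (dist x y) + action p (1 - \<tau>) (dist x (\<gamma> 1))"
    using action_subadditive[of p \<tau> "1 - \<tau>" "dist x y" "dist x (\<gamma> 1)"] \<tau> p by simp
  finally show ?thesis by simp
qed

lemma hl_cost_real: "f y = ereal r \<Longrightarrow> hl_cost p \<tau> (\<lambda>y. - f y) x y = ereal (action p \<tau> (dist x y) - r)"
  by (simp add: hl_cost_def action_def)

lemma hl_cost_MInfty: "f y = - \<infinity> \<Longrightarrow> hl_cost p \<tau> (\<lambda>y. - f y) x y = \<infinity>"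
  by (simp add: hl_cost_def)

lemma f_cases: obtains r where "f y = ereal r" | "f y = - \<infinity>"
  using f_less[of y] by (cases "f y") auto

lemma hopf_lax_eq:
  assumes \<tau>: "0 < \<tau>" "\<tau> < 1"
  shows "hopf_lax p \<tau> (\<lambda>y. - f y) x = ereal (- F \<tau> x)"
proof -
  let ?H = "hopf_lax p \<tau> (\<lambda>y. - f y) x"
  have H: "?H = (INF y. hl_cost p \<tau> (\<lambda>y. - f y) x y)" using \<tau> by (simp add: hopf_lax_def)
  have "?H \<le> ereal (action p \<tau> (dist x (\<gamma> 0)) - f0)"
    unfolding H hl_cost_real[OF ends(1), symmetric] by (rule INF_lower) simp
  moreover have "ereal (g1 - action p (1 - \<tau>) (dist x (\<gamma> 1))) \<le> ?H"
    unfolding H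
  proof (rule INF_greatest)
    fix y
    show "ereal (g1 - action p (1 - \<tau>) (dist x (\<gamma> 1))) \<le> hl_cost p \<tau> (\<lambda>y. - f y) x y"
    proof (cases rule: f_cases[of y])
      case (1 r)
      then show ?thesis using f_bound[OF \<tau> 1, of x] by (simp add: hl_cost_real)
    qed (simp add: hl_cost_MInfty)
  qed
  ultimately have "\<bar>?H\<bar> \<noteq> \<infinity>" by auto
  then show ?thesis by (simp add: interp_def ereal_real')
qed

lemma interp_ge:
  assumes \<tau>: "0 < \<tau>" "\<tau> < 1" and f: "f y = ereal r"
  shows "r - action p \<tau> (dist x y) \<le> F \<tau> x"
proof -
  have "ereal (- F \<tau> x) \<le> hl_cost p \<tau> (\<lambda>y. - f y) x y"
    unfolding hopf_lax_eq[OF \<tau>, symmetric] using \<tau> by (auto simp: hopf_lax_def intro: INF_lower)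
  then show ?thesis by (simp add: hl_cost_real[OF f])
qed

lemma interp_le:
  assumes \<tau>: "0 < \<tau>" "\<tau> < 1" and B: "\<And>y r. f y = ereal r \<Longrightarrow> r - action p \<tau> (dist x y) \<le> B"
  shows "F \<tau> x \<le> B"
proof -
  have "ereal (- B) \<le> hopf_lax p \<tau> (\<lambda>y. - f y) x"
    unfolding hopf_lax_def if_not_P[OF less_imp_neq[OF \<tau>(1), symmetric]]
  proof (rule INF_greatest)
    fix y
    show "ereal (- B) \<le> hl_cost p \<tau> (\<lambda>y. - f y) x y"
    proof (cases rule: f_cases[of y])
      case (1 r)
      then show ?thesis using B[OF 1] by (simp add: hl_cost_real)
    qed (simp add: hl_cost_MInfty)
  qed
  then show ?thesis by (simp add: hopf_lax_eq[OF \<tau>])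
qed

lemma interp_lower: "0 < \<tau> \<Longrightarrow> \<tau> < 1 \<Longrightarrow> f0 - action p \<tau> (dist x (\<gamma> 0)) \<le> F \<tau> x"
  by (rule interp_ge[OF _ _ ends(1)])

lemma interp_upper: "0 < \<tau> \<Longrightarrow> \<tau> < 1 \<Longrightarrow> F \<tau> x \<le> action p (1 - \<tau>) (dist x (\<gamma> 1)) - g1"
  by (rule interp_le) (auto intro: f_bound)

text \<open>
The triangle-inequality half of the Hopf--Lax semigroup law: a motion from \<open>w\<close> to \<open>x\<close> followed by
one from \<open>x\<close> to \<open>y\<close> competes with the direct motion from \<open>w\<close> to \<open>y\<close>.
\<close>
lemma interp_semigroup:
  assumes "0 < \<sigma>" "\<sigma> < \<tau>" "\<tau> < 1"
  shows "F \<sigma> x - action p (\<tau> - \<sigma>) (dist y x) \<le> F \<tau> y"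
proof -
  have "F \<sigma> x \<le> F \<tau> y + action p (\<tau> - \<sigma>) (dist y x)"
  proof (rule interp_le)
    fix w r assume w: "f w = ereal r"
    have "action p \<tau> (dist y w) \<le> action p \<tau> (dist x w + dist y x)"
      using assms dist_triangle[of y w x] by (intro action_mono p) (auto simp: add.commute)
    also have "\<dots> \<le> action p \<sigma> (dist x w) + action p (\<tau> - \<sigma>) (dist y x)"
      using action_subadditive[of p \<sigma> "\<tau> - \<sigma>" "dist x w" "dist y x"] assms p by simp
    finally show "r - action p \<sigma> (dist x w) \<le> F \<tau> y + action p (\<tau> - \<sigma>) (dist y x)"
      using interp_ge[OF _ _ w, of \<tau> y] assms by linarith
  qed (use assms in auto)
  then show ?thesis by simp
qed

lemma action_geod: "0 < u \<Longrightarrow> action p u (u * len) = u * energy"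
  unfolding energy_def by (rule action_scale[OF p _ len_nonneg])

lemma interp_calibrated:
  assumes t: "0 < t" "t < 1"
  shows "F t (\<gamma> t) = f0 - t * energy"
proof (rule antisym)
  have "F t (\<gamma> t) \<le> action p (1 - t) ((1 - t) * len) - g1"
    using interp_upper[OF t, of "\<gamma> t"] dist_geod[of t 1] t by (simp add: dist_commute)
  then show "F t (\<gamma> t) \<le> f0 - t * energy"
    using t ends(3) action_geod[of "1 - t"] by (simp add: algebra_simps)
  show "f0 - t * energy \<le> F t (\<gamma> t)"
    using interp_lower[OF t, of "\<gamma> t"] dist_geod[of 0 t] t action_geod[of t] by simp
qed

lemma action_deriv_geod:
  assumes u: "0 < u"
  shows "((\<lambda>v. action p v (u * len)) has_real_derivative - ((p - 1) * energy)) (at u)"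
proof -
  have "(u * len) powr p / p / u powr p = energy"
    using u len_nonneg by (simp add: powr_mult energy_def)
  then have "(p - 1) * ((u * len) powr p / p) / u powr p = (p - 1) * energy"
    by (metis times_divide_eq_right)
  then show ?thesis using action_deriv[OF p u, of "u * len"] by simp
qed

lemma eventually_in_unit:
  assumes "0 < t" "t < (1::real)"
  shows "eventually (\<lambda>\<tau>. 0 < \<tau> \<and> \<tau> < 1) (nhds t)"
proof -
  have "eventually (\<lambda>\<tau>. \<tau> \<in> {0<..<1}) (nhds t)"
    using assms by (intro eventually_nhds_in_open) auto
  then show ?thesis by simp
qed

text \<open>
As a function of \<open>\<tau>\<close>, the interpolation at the fixed point \<open>\<gamma> t\<close> is squeezed between the competitor
started at \<open>\<gamma> 0\<close> and the dual competitor \<open>\<gamma> 1\<close>. These are smooth in \<open>\<tau>\<close>, meet at \<open>\<tau> = t\<close>, and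
have the same derivative there because \<open>\<gamma>\<close> has constant speed.
\<close>
lemma interp_deriv:
  assumes t: "0 < t" "t < 1"
  shows "((\<lambda>\<tau>. F \<tau> (\<gamma> t)) has_real_derivative (p - 1) * energy) (at t)"
proof (rule has_real_derivative_squeeze)
  show "((\<lambda>\<tau>. f0 - action p \<tau> (t * len)) has_real_derivative (p - 1) * energy) (at t)"
    using DERIV_diff[OF DERIV_const action_deriv_geod[OF t(1)]] by simp
  have "((\<lambda>\<tau>. 1 - \<tau>) has_real_derivative - 1) (at t)"
    by (auto intro!: derivative_eq_intros)
  then have "((\<lambda>\<tau>. action p (1 - \<tau>) ((1 - t) * len)) has_real_derivative - ((p - 1) * energy) * - 1) (at t)"
    using t by (intro DERIV_chain2[OF action_deriv_geod]) auto
  from DERIV_diff[OF this DERIV_const]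
  show "((\<lambda>\<tau>. action p (1 - \<tau>) ((1 - t) * len) - g1) has_real_derivative (p - 1) * energy) (at t)"
    by simp
  show "eventually (\<lambda>\<tau>. f0 - action p \<tau> (t * len) \<le> F \<tau> (\<gamma> t) \<and>
      F \<tau> (\<gamma> t) \<le> action p (1 - \<tau>) ((1 - t) * len) - g1) (nhds t)"
    using eventually_in_unit[OF t]
  proof eventually_elim
    case (elim \<tau>)
    then show ?case
      using interp_lower[of \<tau> "\<gamma> t"] interp_upper[of \<tau> "\<gamma> t"] dist_geod[of 0 t] dist_geod[of t 1] t
      by (simp add: dist_commute)
  qed
  show "f0 - action p t (t * len) = F t (\<gamma> t)"
    using t by (simp add: action_geod interp_calibrated)
  show "action p (1 - t) ((1 - t) * len) - g1 = F t (\<gamma> t)"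
    using t ends(3) action_geod[of "1 - t"] by (simp add: interp_calibrated left_diff_distrib)
qed

section \<open>Minimizing sequences and speeds\<close>

text \<open>
A minimizing sequence for the time \<open>\<tau>\<close> supplies competitors for every other time \<open>\<tau>'\<close>. The same
values \<open>a n\<close> serve all \<open>\<tau>'\<close>, so that \<open>\<tau>'\<close> may be varied freely afterwards.
\<close>
lemma minimizing_seq_ineq:
  assumes \<tau>: "0 < \<tau>" "\<tau> < 1" and y: "y \<in> minimizing_seqs p (\<lambda>y. - f y) x \<tau>"
  obtains a where "a \<longlonglongrightarrow> F \<tau> x"
    and "eventually (\<lambda>n. \<forall>\<tau>'. 0 < \<tau>' \<longrightarrow> \<tau>' < 1 \<longrightarrow>
      a n + action p \<tau> (dist x (y n)) - action p \<tau>' (dist x (y n)) \<le> F \<tau>' x) sequentially"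
proof
  let ?c = "\<lambda>n. hl_cost p \<tau> (\<lambda>y. - f y) x (y n)"
  have lim: "?c \<longlonglongrightarrow> ereal (- F \<tau> x)"
    using y \<tau> by (simp add: minimizing_seqs_def hopf_lax_eq)
  from tendsto_minus[OF lim_real_of_ereal[OF lim]]
  show "(\<lambda>n. - real_of_ereal (?c n)) \<longlonglongrightarrow> F \<tau> x" by simp
  have "eventually (\<lambda>n. ?c n < \<infinity>) sequentially"
    using lim by (rule order_tendstoD) simp
  then show "eventually (\<lambda>n. \<forall>\<tau>'. 0 < \<tau>' \<longrightarrow> \<tau>' < 1 \<longrightarrow>
      - real_of_ereal (?c n) + action p \<tau> (dist x (y n)) - action p \<tau>' (dist x (y n)) \<le> F \<tau>' x) sequentially"
  proof eventually_elim
    case (elim n)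
    then have "f (y n) \<noteq> - \<infinity>" using hl_cost_MInfty[of "y n" \<tau> x] by auto
    then obtain r where r: "f (y n) = ereal r"
      using f_less[of "y n"] by (cases "f (y n)") auto
    show ?case using interp_ge[OF _ _ r, of _ x] by (auto simp: hl_cost_real[OF r])
  qed
qed

lemma minimizing_seq_bounded:
  assumes \<tau>: "0 < \<tau>" "\<tau> < 1" and y: "y \<in> minimizing_seqs p (\<lambda>y. - f y) x \<tau>"
  obtains B where "eventually (\<lambda>n. dist x (y n) \<le> B) sequentially"
proof -
  from minimizing_seq_ineq[OF \<tau> y] obtain a where a: "a \<longlonglongrightarrow> F \<tau> x"
    and ineq: "eventually (\<lambda>n. \<forall>\<tau>'. 0 < \<tau>' \<longrightarrow> \<tau>' < 1 \<longrightarrow>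
      a n + action p \<tau> (dist x (y n)) - action p \<tau>' (dist x (y n)) \<le> F \<tau>' x) sequentially" .
  \<comment> \<open>At any later time far competitors are cheaper by a fixed multiple of \<open>d\<^sup>p\<close>, and the interpolation
    stays finite there.\<close>
  define \<tau>' where "\<tau>' = (1 + \<tau>) / 2"
  have \<tau>': "\<tau> < \<tau>'" "0 < \<tau>'" "\<tau>' < 1" using \<tau> by (auto simp: \<tau>'_def)
  define c where "c = 1 / (p * \<tau> powr (p - 1)) - 1 / (p * \<tau>' powr (p - 1))"
  have "p * \<tau> powr (p - 1) < p * \<tau>' powr (p - 1)"
    using p \<tau> \<tau>' by (intro mult_strict_left_mono powr_less_mono2) auto
  then have c: "c > 0" using p \<tau> by (auto simp: c_def intro!: divide_strict_left_mono mult_pos_pos)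
  define M where "M = (F \<tau>' x - F \<tau> x + 1) / c"
  have "eventually (\<lambda>n. F \<tau> x - 1 < a n) sequentially"
    using a by (rule order_tendstoD) simp
  with ineq have "eventually (\<lambda>n. dist x (y n) \<le> max 1 M) sequentially"
  proof eventually_elim
    case (elim n)
    let ?d = "dist x (y n)"
    have "a n + action p \<tau> ?d - action p \<tau>' ?d \<le> F \<tau>' x" using elim \<tau>' by blast
    moreover have "action p \<tau> ?d - action p \<tau>' ?d = c * ?d powr p"
      by (simp add: action_def c_def algebra_simps)
    ultimately have "?d powr p * c \<le> F \<tau>' x - F \<tau> x + 1" using elim by (simp add: mult.commute)
    then have dM: "?d powr p \<le> M" unfolding M_def using c by (simp add: pos_le_divide_eq)
    show ?case
    proof (cases "?d \<le> 1")
      case False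
      then have "?d powr 1 \<le> ?d powr p" using p by (intro powr_mono) auto
      then show ?thesis using dM False by simp
    qed simp
  qed
  then show ?thesis by (rule that)
qed

text \<open>
The limiting distance along a minimizing sequence gives a subgradient of \<open>\<tau> \<mapsto> F \<tau> x\<close>, expressed through
the action instead of a linear function.
\<close>
lemma minimizing_seq_limit:
  assumes \<tau>: "0 < \<tau>" "\<tau> < 1" and y: "y \<in> minimizing_seqs p (\<lambda>y. - f y) x \<tau>"
    and L: "(\<lambda>n. dist x (y n)) \<longlonglongrightarrow> L" and \<tau>': "0 < \<tau>'" "\<tau>' < 1"
  shows "action p \<tau> L - action p \<tau>' L \<le> F \<tau>' x - F \<tau> x"
proof -
  from minimizing_seq_ineq[OF \<tau> y] obtain a where a: "a \<longlonglongrightarrow> F \<tau> x"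
    and ineq: "eventually (\<lambda>n. \<forall>\<tau>'. 0 < \<tau>' \<longrightarrow> \<tau>' < 1 \<longrightarrow>
      a n + action p \<tau> (dist x (y n)) - action p \<tau>' (dist x (y n)) \<le> F \<tau>' x) sequentially" .
  have "(\<lambda>n. a n + action p \<tau> (dist x (y n)) - action p \<tau>' (dist x (y n)))
      \<longlonglongrightarrow> F \<tau> x + action p \<tau> L - action p \<tau>' L"
    by (intro tendsto_intros a tendsto_action p L) auto
  then have "F \<tau> x + action p \<tau> L - action p \<tau>' L \<le> F \<tau>' x"
  proof (rule tendsto_upperbound)
    show "eventually (\<lambda>n. a n + action p \<tau> (dist x (y n)) - action p \<tau>' (dist x (y n)) \<le> F \<tau>' x) sequentially"
      using ineq by (rule eventually_mono) (use \<tau>' in blast)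
  qed simp
  then show ?thesis by simp
qed

lemma minimizing_seq_exists:
  assumes \<tau>: "0 < \<tau>"
  obtains y where "y \<in> minimizing_seqs p (\<lambda>y. - f y) x \<tau>"
proof -
  obtain u where u: "\<And>n. u n \<in> range (hl_cost p \<tau> (\<lambda>y. - f y) x)"
      "u \<longlonglongrightarrow> Inf (range (hl_cost p \<tau> (\<lambda>y. - f y) x))"
    using Inf_as_limit[of "range (hl_cost p \<tau> (\<lambda>y. - f y) x)"] by auto
  have "\<forall>n. \<exists>y. u n = hl_cost p \<tau> (\<lambda>y. - f y) x y" using u(1) by blast
  then obtain y where "\<And>n. u n = hl_cost p \<tau> (\<lambda>y. - f y) x (y n)" by metis
  then have "u = (\<lambda>n. hl_cost p \<tau> (\<lambda>y. - f y) x (y n))" by blast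
  then show ?thesis
    using u(2) \<tau> by (intro that[of y]) (simp add: minimizing_seqs_def hopf_lax_def)
qed

lemma minimizing_seq_subseq:
  "y \<in> minimizing_seqs p h x \<tau> \<Longrightarrow> strict_mono k \<Longrightarrow> y \<circ> k \<in> minimizing_seqs p h x \<tau>"
  unfolding minimizing_seqs_def mem_Collect_eq
  by (drule (1) LIMSEQ_subseq_LIMSEQ) (simp add: o_def)

text \<open>
On the geodesic the interpolation is differentiable in time with known derivative, and a
differentiable function has only one subgradient. So every limiting distance is the distance from
\<open>\<gamma> t\<close> to \<open>\<gamma> 0\<close>.
\<close>
lemma minimizing_seq_limit_geod:
  assumes t: "0 < t" "t < 1" and y: "y \<in> minimizing_seqs p (\<lambda>y. - f y) (\<gamma> t) t"
    and L: "(\<lambda>n. dist (\<gamma> t) (y n)) \<longlonglongrightarrow> L"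
  shows "L = t * len"
proof -
  have L0: "L \<ge> 0" using L by (rule LIMSEQ_le_const) auto
  define H where "H \<tau> = F \<tau> (\<gamma> t) + action p \<tau> L" for \<tau>
  have "(H has_real_derivative (p - 1) * energy + - ((p - 1) * (L powr p / p) / t powr p)) (at t)"
    unfolding H_def by (intro DERIV_add interp_deriv action_deriv p t)
  moreover have "\<forall>\<tau>. \<bar>t - \<tau>\<bar> < min t (1 - t) \<longrightarrow> H t \<le> H \<tau>"
  proof (intro allI impI)
    fix \<tau> assume "\<bar>t - \<tau>\<bar> < min t (1 - t)"
    then have "0 < \<tau>" "\<tau> < 1" by linarith+
    from minimizing_seq_limit[OF t y L this] show "H t \<le> H \<tau>" by (simp add: H_def)
  qed
  ultimately have "(p - 1) * energy + - ((p - 1) * (L powr p / p) / t powr p) = 0"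
    using t by (intro DERIV_local_min[of H _ t "min t (1 - t)"]) auto
  then have "(p - 1) * (L powr p / p / t powr p - energy) = 0" by (simp add: algebra_simps)
  then have "L powr p / p / t powr p = energy" using p by simp
  then have "L powr p = p * energy * t powr p" using p t by (simp add: divide_eq_eq mult_ac)
  then have "L powr p = t powr p * len powr p" using p by (simp add: energy_def)
  also have "\<dots> = (t * len) powr p" using t len_nonneg by (simp add: powr_mult)
  finally have "(L powr p) powr (1 / p) = ((t * len) powr p) powr (1 / p)" by simp
  then show ?thesis unfolding powr_powr using p L0 t len_nonneg by simp
qed

text \<open>
The distances along a minimizing sequence are bounded, and both extreme limits are attained along
subsequences, which are again minimizing.
\<close>
lemma minimizing_seq_dist_liminf_limsup:
  assumes t: "0 < t" "t < 1" and y: "y \<in> minimizing_seqs p (\<lambda>y. - f y) (\<gamma> t) t"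
  shows "limsup (\<lambda>n. ereal (dist (\<gamma> t) (y n))) = ereal (t * len)"
    and "liminf (\<lambda>n. ereal (dist (\<gamma> t) (y n))) = ereal (t * len)"
proof -
  let ?d = "\<lambda>n. ereal (dist (\<gamma> t) (y n))"
  obtain B where B: "eventually (\<lambda>n. dist (\<gamma> t) (y n) \<le> B) sequentially"
    using minimizing_seq_bounded[OF t y] .
  have *: "l = ereal (t * len)" if k: "strict_mono k" and lim: "(?d \<circ> k) \<longlonglongrightarrow> l" for k l
  proof -
    have "eventually (\<lambda>n. (?d \<circ> k) n \<le> ereal B) sequentially"
      using eventually_subseq[OF k B] by simp
    then have "l \<le> ereal B" using lim by (intro tendsto_upperbound) auto
    moreover have "0 \<le> l" using lim by (intro tendsto_lowerbound) auto
    ultimately obtain L where L: "l = ereal L" by (cases l) auto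
    then have "(\<lambda>n. dist (\<gamma> t) ((y \<circ> k) n)) \<longlonglongrightarrow> L"
      using lim by (simp add: o_def)
    from minimizing_seq_limit_geod[OF t minimizing_seq_subseq[OF y k] this] L show ?thesis by simp
  qed
  show "limsup ?d = ereal (t * len)" using limsup_subseq_lim[of ?d] * by blast
  show "liminf ?d = ereal (t * len)" using liminf_subseq_lim[of ?d] * by blast
qed

lemma speed_calibrated:
  assumes t: "0 < t" "t < 1"
  shows "ell_plus p f t (\<gamma> t) = ereal len" "ell_minus p f t (\<gamma> t) = ereal len"
proof -
  obtain y0 where "y0 \<in> minimizing_seqs p (\<lambda>y. - f y) (\<gamma> t) t"
    using minimizing_seq_exists[OF t(1)] .
  then have ne: "minimizing_seqs p (\<lambda>y. - f y) (\<gamma> t) t \<noteq> {}" by blast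
  have "D_plus p (\<lambda>y. - f y) (\<gamma> t) t = ereal (t * len)"
    unfolding D_plus_def using ne by (simp add: minimizing_seq_dist_liminf_limsup[OF t])
  moreover have "D_minus p (\<lambda>y. - f y) (\<gamma> t) t = ereal (t * len)"
    unfolding D_minus_def using ne by (simp add: minimizing_seq_dist_liminf_limsup[OF t])
  ultimately show "ell_plus p f t (\<gamma> t) = ereal len" "ell_minus p f t (\<gamma> t) = ereal len"
    using t by (auto simp: ell_plus_def ell_minus_def)
qed

lemma calibrated_in_D_ell:
  assumes t: "0 < t" "t < 1"
  shows "t \<in> D_ell p f (\<gamma> t)" "ell p f t (\<gamma> t) = len"
  using t by (simp_all add: D_ell_def ell_def speed_calibrated)

text \<open>
Where the two extreme speeds agree, the distances along every minimizing sequence converge, so the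
common speed is a subgradient.
\<close>
lemma speed_subgradient:
  assumes \<tau>: "\<tau> \<in> D_ell p f x"
  shows "0 \<le> ell p f \<tau> x"
    and "\<And>\<tau>'. 0 < \<tau>' \<Longrightarrow> \<tau>' < 1 \<Longrightarrow>
      action p \<tau> (\<tau> * ell p f \<tau> x) - action p \<tau>' (\<tau> * ell p f \<tau> x) \<le> F \<tau>' x - F \<tau> x"
proof -
  have t: "0 < \<tau>" "\<tau> < 1" and eq: "ell_plus p f \<tau> x = ell_minus p f \<tau> x"
    using \<tau> by (auto simp: D_ell_def)
  obtain y where y: "y \<in> minimizing_seqs p (\<lambda>y. - f y) x \<tau>"
    using minimizing_seq_exists[OF t(1)] .
  let ?d = "\<lambda>n. ereal (dist x (y n))"
  let ?P = "D_plus p (\<lambda>y. - f y) x \<tau>" and ?M = "D_minus p (\<lambda>y. - f y) x \<tau>"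
  have "?P = ?M"
  proof -
    have "ereal \<tau> * (?P / ereal \<tau>) = ereal \<tau> * (?M / ereal \<tau>)"
      using eq by (simp add: ell_plus_def ell_minus_def)
    then show ?thesis using t by (simp add: ereal_mult_divide)
  qed
  moreover have up: "limsup ?d \<le> ?P" unfolding D_plus_def by (rule SUP_upper[OF y])
  moreover have lo: "?M \<le> liminf ?d" unfolding D_minus_def by (rule INF_lower[OF y])
  moreover have "liminf ?d \<le> limsup ?d" by (rule Liminf_le_Limsup) simp
  ultimately have lim: "liminf ?d = ?P" "limsup ?d = ?P" by auto
  then have conv: "?d \<longlonglongrightarrow> ?P" by (simp add: tendsto_iff_Liminf_eq_Limsup)
  obtain B where B: "eventually (\<lambda>n. dist x (y n) \<le> B) sequentially"
    using minimizing_seq_bounded[OF t y] .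
  have "?P \<le> ereal B" using conv B by (intro tendsto_upperbound[OF conv]) auto
  moreover have P0: "0 \<le> ?P" by (intro tendsto_lowerbound[OF conv]) auto
  ultimately obtain L where L: "?P = ereal L" by (cases ?P) auto
  have ell: "\<tau> * ell p f \<tau> x = L" using t L by (simp add: ell_def ell_plus_def)
  have L0: "0 \<le> L" using P0 L by simp
  show "0 \<le> ell p f \<tau> x" using ell L0 t by (metis linorder_not_le mult_pos_neg)
  have "(\<lambda>n. dist x (y n)) \<longlonglongrightarrow> L" using conv L by simp
  from minimizing_seq_limit[OF t y this]
  show "action p \<tau> (\<tau> * ell p f \<tau> x) - action p \<tau>' (\<tau> * ell p f \<tau> x) \<le> F \<tau>' x - F \<tau> x"
    if "0 < \<tau>'" "\<tau>' < 1" for \<tau>' using that unfolding ell by blast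
qed

text \<open>
The speed is a subgradient selection up to a quadratic error proportional to its own \<open>p\<close>-th power.
Hence it has to be bounded near \<open>t\<close> first; then \<open>subgradient_has_derivative\<close> applies.
\<close>
lemma speed_has_derivative:
  assumes t: "0 < t" "t < 1" and second: "has_second_derivative (\<lambda>\<tau>. F \<tau> (\<gamma> t)) \<Delta> t"
  shows "((\<lambda>\<tau>. (p - 1) * ell p f \<tau> (\<gamma> t) powr p / p) has_real_derivative \<Delta>) (at t within D_ell p f (\<gamma> t))"
proof -
  define x where "x = \<gamma> t"
  define e where "e \<tau> = ell p f \<tau> x powr p / p" for \<tau>
  have e0: "0 \<le> e \<tau>" for \<tau> using p by (simp add: e_def)
  define C where "C = p * (p - 1) / 2 + 1"
  have C: "C > 0" using p by (simp add: C_def add_pos_pos)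
  obtain \<rho> where \<rho>: "\<rho> > 0" and sub: "\<And>\<tau> k l. 0 < \<tau> \<Longrightarrow> 0 \<le> l \<Longrightarrow> \<bar>k\<bar> \<le> \<rho> * \<tau> \<Longrightarrow>
      (p - 1) * (l powr p / p) * k - C * (l powr p / p) * k\<^sup>2 / \<tau>
      \<le> action p \<tau> (\<tau> * l) - action p (\<tau> + k) (\<tau> * l)"
    using action_subgradient[OF p] unfolding C_def by blast
  have sub': "(p - 1) * e \<tau> * k - C * e \<tau> * k\<^sup>2 / \<tau> \<le> F (\<tau> + k) x - F \<tau> x"
    if "\<tau> \<in> D_ell p f x" "0 < \<tau>" "0 < \<tau> + k" "\<tau> + k < 1" "\<bar>k\<bar> \<le> \<rho> * \<tau>" for \<tau> k
    using sub[OF that(2) speed_subgradient(1)[OF that(1)] that(5)]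
      speed_subgradient(2)[OF that(1) that(3,4)] unfolding e_def by linarith
  \<comment> \<open>The radius \<open>\<delta>\<close> keeps \<open>\<tau>\<close> above \<open>t/2\<close> and \<open>\<tau> + \<delta>\<close> below \<open>(1 + t)/2\<close>, stays within the range
    of the Taylor estimate, and makes the quadratic error at most half the linear term.\<close>
  define t0 where "t0 = t / 2"
  define \<delta> where "\<delta> = Min {t0 / 2, (1 - t) / 4, \<rho> * t0 / 2, (p - 1) * t0 / (2 * C)}"
  have \<delta>: "\<delta> > 0" using t \<rho> C p by (simp add: \<delta>_def t0_def)
  have \<delta>1: "\<delta> \<le> t0 / 2" and \<delta>2: "\<delta> \<le> (1 - t) / 4" and \<delta>3: "\<delta> \<le> \<rho> * t0 / 2" and \<delta>4: "\<delta> \<le> (p - 1) * t0 / (2 * C)"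
    unfolding \<delta>_def by (rule Min_le; simp)+
  have t0: "t0 > 0" using t by (simp add: t0_def)
  define M where "M = (action p ((1 - t) / 2) (dist x (\<gamma> 1)) - g1 - f0 + action p t0 (dist x (\<gamma> 0))) / (\<delta> * (p - 1) / 2)"
  \<comment> \<open>A step of the fixed size \<open>\<delta>\<close> bounds the subgradient by the oscillation of the interpolation.\<close>
  have bound: "e \<tau> \<le> M" if \<tau>: "\<tau> \<in> D_ell p f x" "\<bar>\<tau> - t\<bar> < \<delta>" for \<tau>
  proof -
    have \<tau>0: "t0 \<le> \<tau>" using \<tau> \<delta>1 t by (simp add: t0_def)
    have \<tau>1: "\<tau> + \<delta> \<le> 1 - (1 - t) / 2" "\<tau> + \<delta> < 1" using \<tau> \<delta>2 t by (auto simp: field_simps)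
    have \<delta>\<tau>: "\<delta> \<le> \<rho> * \<tau>"
    proof -
      have "\<rho> * t0 \<le> \<rho> * \<tau>" "0 < \<rho> * t0" using \<rho> \<tau>0 t0 by auto
      then show ?thesis using \<delta>3 by linarith
    qed
    have "C * e \<tau> * \<delta>\<^sup>2 / \<tau> \<le> C * e \<tau> * \<delta>\<^sup>2 / t0"
      using \<tau>0 t0 C e0[of \<tau>] by (intro divide_left_mono) auto
    also have "\<dots> = (C * \<delta> / t0) * (e \<tau> * \<delta>)" by (simp add: power2_eq_square)
    also have "\<dots> \<le> ((p - 1) / 2) * (e \<tau> * \<delta>)"
    proof (rule mult_right_mono)
      have "C * \<delta> \<le> (p - 1) / 2 * t0" using \<delta>4 C by (simp add: field_simps)
      then show "C * \<delta> / t0 \<le> (p - 1) / 2" using t0 by (simp add: pos_divide_le_eq)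
    qed (use e0[of \<tau>] \<delta> in auto)
    finally have le: "C * e \<tau> * \<delta>\<^sup>2 / \<tau> \<le> ((p - 1) / 2) * (e \<tau> * \<delta>)" .
    have "(p - 1) * e \<tau> * \<delta> - ((p - 1) / 2) * (e \<tau> * \<delta>) \<le> F (\<tau> + \<delta>) x - F \<tau> x"
    proof -
      have "0 < \<tau>" "0 < \<tau> + \<delta>" "\<bar>\<delta>\<bar> \<le> \<rho> * \<tau>" using \<tau>0 t0 \<delta> \<delta>\<tau> by auto
      with sub'[of \<tau> \<delta>] \<tau>(1) \<tau>1(2)
      have "(p - 1) * e \<tau> * \<delta> - C * e \<tau> * \<delta>\<^sup>2 / \<tau> \<le> F (\<tau> + \<delta>) x - F \<tau> x" by blast
      with le show ?thesis by linarith
    qed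
    moreover have "F (\<tau> + \<delta>) x \<le> action p ((1 - t) / 2) (dist x (\<gamma> 1)) - g1"
    proof -
      have "action p (1 - (\<tau> + \<delta>)) (dist x (\<gamma> 1)) \<le> action p ((1 - t) / 2) (dist x (\<gamma> 1))"
      proof (intro action_antimono p)
        show "0 < (1 - t) / 2" using t by simp
        show "(1 - t) / 2 \<le> 1 - (\<tau> + \<delta>)" using \<tau>1 by linarith
      qed
      then show ?thesis using interp_upper[of "\<tau> + \<delta>" x] \<tau>0 \<tau>1 \<delta> t0 by linarith
    qed
    moreover have "f0 - action p t0 (dist x (\<gamma> 0)) \<le> F \<tau> x"
      using action_antimono[of p t0 \<tau> "dist x (\<gamma> 0)"] interp_lower[of \<tau> x] \<tau>0 \<tau>1 \<delta> t0 p by linarith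
    ultimately have "e \<tau> * (\<delta> * (p - 1) / 2)
        \<le> action p ((1 - t) / 2) (dist x (\<gamma> 1)) - g1 - f0 + action p t0 (dist x (\<gamma> 0))"
      by (simp add: field_simps)
    then show ?thesis unfolding M_def using \<delta> p by (simp add: pos_le_divide_eq)
  qed
  have peano: "((\<lambda>h. (F (t + h) x - F t x - (p - 1) * e t * h) / h\<^sup>2) \<longlongrightarrow> \<Delta> / 2) (at 0)"
    using second unfolding has_second_derivative_iff[OF interp_deriv[OF t]]
    by (simp add: x_def e_def calibrated_in_D_ell[OF t] energy_def)
  have "((\<lambda>\<tau>. (p - 1) * e \<tau>) has_real_derivative \<Delta>) (at t within D_ell p f x)"
  proof (rule subgradient_has_derivative
      [where G = "\<lambda>\<tau>. F \<tau> x" and m = "\<lambda>\<tau>. (p - 1) * e \<tau>", OF peano \<delta>])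
    fix \<tau> k assume \<tau>: "\<tau> \<in> D_ell p f x" "\<bar>\<tau> - t\<bar> < \<delta>" and k: "\<bar>k\<bar> < \<delta>"
    have \<tau>0: "t0 \<le> \<tau>" using \<tau> \<delta>1 t by (simp add: t0_def)
    have "\<rho> * t0 \<le> \<rho> * \<tau>" "0 < \<rho> * t0" using \<rho> \<tau>0 t0 by auto
    then have k\<rho>: "\<bar>k\<bar> \<le> \<rho> * \<tau>" using \<delta>3 k by linarith
    have "\<tau> + k < 1" using \<tau> k \<delta>2 t by (auto simp: field_simps)
    moreover have "0 < \<tau> + k" using \<tau>0 k \<delta>1 t0 by linarith
    moreover have "0 < \<tau>" using \<tau>0 t0 by linarith
    ultimately have "(p - 1) * e \<tau> * k - C * e \<tau> * k\<^sup>2 / \<tau> \<le> F (\<tau> + k) x - F \<tau> x"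
      using sub' \<tau> k\<rho> by blast
    moreover have "C * e \<tau> * k\<^sup>2 / \<tau> \<le> (C * M / t0) * k\<^sup>2"
    proof -
      have "C * e \<tau> * k\<^sup>2 / \<tau> \<le> C * e \<tau> * k\<^sup>2 / t0"
        using \<tau>0 t0 C e0[of \<tau>] by (intro divide_left_mono) auto
      also have "\<dots> \<le> C * M * k\<^sup>2 / t0"
        using bound[OF \<tau>] C t0 by (intro divide_right_mono mult_right_mono mult_left_mono) auto
      finally show ?thesis by simp
    qed
    ultimately show "(p - 1) * e \<tau> * k - (C * M / t0) * k\<^sup>2 \<le> F (\<tau> + k) x - F \<tau> x" by linarith
  qed
  then show ?thesis by (simp add: e_def x_def)
qed

section \<open>Second time derivatives along the geodesic\<close>

text \<open>
The first-order part \<open>(p - 1) energy \<epsilon>\<close> is the same at every point of the geodesic, which is what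
makes second-order behaviour at different points comparable.
\<close>
definition remainder :: "real \<Rightarrow> real \<Rightarrow> real" where
  "remainder t \<epsilon> = F (t + \<epsilon>) (\<gamma> t) - F t (\<gamma> t) - (p - 1) * energy * \<epsilon>"

lemma has_second_derivative_remainder:
  assumes t: "0 < t" "t < 1"
  shows "has_second_derivative (\<lambda>\<tau>. F \<tau> (\<gamma> t)) \<Delta> t \<longleftrightarrow>
    ((\<lambda>\<epsilon>. remainder t \<epsilon> / \<epsilon>\<^sup>2) \<longlongrightarrow> \<Delta> / 2) (at 0)"
  unfolding has_second_derivative_iff[OF interp_deriv[OF t]] remainder_def ..

text \<open>
The semigroup inequality along the geodesic, with the terms of order zero and one cancelled. The
two time shifts \<open>\<delta>\<close> at \<open>s\<close> and \<open>\<epsilon>\<close> at \<open>t\<close> are independent; the price for choosing them differently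
is the second-order excess of the action.
\<close>
lemma remainder_compare:
  assumes s: "0 < s" and st: "s < t" and t: "t < 1"
    and \<delta>: "0 < s + \<delta>" and lt: "s + \<delta> < t + \<epsilon>" and \<epsilon>: "t + \<epsilon> < 1"
  shows "remainder s \<delta> - (action p (t - s + (\<epsilon> - \<delta>)) ((t - s) * len) - (t - s) * energy
      + (p - 1) * energy * (\<epsilon> - \<delta>)) \<le> remainder t \<epsilon>"
proof -
  have "F (s + \<delta>) (\<gamma> s) - action p (t + \<epsilon> - (s + \<delta>)) (dist (\<gamma> t) (\<gamma> s)) \<le> F (t + \<epsilon>) (\<gamma> t)"
    using assms by (intro interp_semigroup)
  moreover have "dist (\<gamma> t) (\<gamma> s) = (t - s) * len" using assms by (intro dist_geod) auto
  moreover have "t + \<epsilon> - (s + \<delta>) = t - s + (\<epsilon> - \<delta>)" by simp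
  ultimately show ?thesis
    using assms by (simp add: remainder_def interp_calibrated algebra_simps)
qed

lemma remainder_mono:
  assumes "0 < s" "s < t" "t < 1" "0 < s + \<epsilon>" "t + \<epsilon> < 1"
  shows "remainder s \<epsilon> \<le> remainder t \<epsilon>"
  using remainder_compare[of s t \<epsilon> \<epsilon>] action_geod[of "t - s"] assms by simp

lemma remainder_scaled:
  assumes t: "0 < t" "t < 1" and second: "has_second_derivative (\<lambda>\<tau>. F \<tau> (\<gamma> t)) \<Delta> t"
  shows "((\<lambda>\<eta>. remainder t (a * \<eta>) / \<eta>\<^sup>2) \<longlongrightarrow> \<Delta> / 2 * a\<^sup>2) (at 0)"
proof (cases "a = 0")
  case False
  have "((\<lambda>\<eta>. a * \<eta>) \<longlongrightarrow> 0) (at 0)" by (rule tendsto_mult_right_zero) simp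
  then have "filterlim (\<lambda>\<eta>. a * \<eta>) (at 0) (at 0)"
    using False by (auto simp: filterlim_at eventually_at intro!: exI[of _ 1])
  then have "((\<lambda>\<eta>. remainder t (a * \<eta>) / (a * \<eta>)\<^sup>2 * a\<^sup>2) \<longlongrightarrow> \<Delta> / 2 * a\<^sup>2) (at 0)"
    using second unfolding has_second_derivative_remainder[OF t]
    by (intro tendsto_mult tendsto_const) (rule filterlim_compose)
  then show ?thesis using False by (simp add: power_mult_distrib)
qed (simp add: remainder_def)

text \<open>
Shifting time by \<open>b \<eta>\<close> at \<open>s\<close> and by \<open>a \<eta>\<close> at \<open>t\<close> and letting \<open>\<eta>\<close> tend to \<open>0\<close> turns
\<open>remainder_compare\<close> into the positivity of a quadratic form in \<open>(a, b)\<close>.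
\<close>
lemma second_derivative_form:
  assumes s: "0 < s" and st: "s < t" and t: "t < 1"
    and ds: "has_second_derivative (\<lambda>\<tau>. F \<tau> (\<gamma> s)) \<Delta>s s"
    and dt: "has_second_derivative (\<lambda>\<tau>. F \<tau> (\<gamma> t)) \<Delta>t t"
  shows "0 \<le> \<Delta>t * a\<^sup>2 - \<Delta>s * b\<^sup>2 + (p - 1) * len powr p / (t - s) * (a - b)\<^sup>2"
proof -
  let ?C = "\<lambda>\<eta>. action p (t - s + (a - b) * \<eta>) ((t - s) * len) - (t - s) * energy + (p - 1) * energy * ((a - b) * \<eta>)"
  have lim: "((\<lambda>\<eta>. remainder s (b * \<eta>) / \<eta>\<^sup>2 - ?C \<eta> / \<eta>\<^sup>2) \<longlongrightarrow>
      \<Delta>s / 2 * b\<^sup>2 - (p - 1) * len powr p * (a - b)\<^sup>2 / (2 * (t - s))) (at 0)"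
    unfolding energy_def
    using assms len_nonneg p by (intro tendsto_diff remainder_scaled action_second_order) auto
  have lim': "((\<lambda>\<eta>. remainder t (a * \<eta>) / \<eta>\<^sup>2) \<longlongrightarrow> \<Delta>t / 2 * a\<^sup>2) (at 0)"
    using assms by (intro remainder_scaled) auto
  have small: "eventually (\<lambda>\<eta>. c * \<eta> < d) (at 0)" if "d > 0" for c d :: real
  proof -
    have "((\<lambda>\<eta>. c * \<eta>) \<longlongrightarrow> 0) (at 0)" by (rule tendsto_mult_right_zero) simp
    then show ?thesis using that by (rule order_tendstoD)
  qed
  have "eventually (\<lambda>\<eta>. remainder s (b * \<eta>) / \<eta>\<^sup>2 - ?C \<eta> / \<eta>\<^sup>2 \<le> remainder t (a * \<eta>) / \<eta>\<^sup>2) (at 0)"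
  proof -
    have "1 - t > 0" "t - s > 0" using assms by auto
    from small[of s "- b", OF s] small[OF this(1), of a] small[OF this(2), of "b - a"]
    show ?thesis
    proof eventually_elim
      case (elim \<eta>)
      have "remainder s (b * \<eta>) - ?C \<eta> \<le> remainder t (a * \<eta>)"
        using remainder_compare[of s t "b * \<eta>" "a * \<eta>"] elim assms by (simp add: algebra_simps)
      from divide_right_mono[OF this, of "\<eta>\<^sup>2"] show ?case by (simp only: diff_divide_distrib zero_le_power2)
    qed
  qed
  with lim lim' have "\<Delta>s / 2 * b\<^sup>2 - (p - 1) * len powr p * (a - b)\<^sup>2 / (2 * (t - s)) \<le> \<Delta>t / 2 * a\<^sup>2"
    by (intro tendsto_le[OF _ lim' lim]) auto
  moreover define W where "W = (p - 1) * len powr p / (t - s) * (a - b)\<^sup>2"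
  moreover have "(p - 1) * len powr p * (a - b)\<^sup>2 / (2 * (t - s)) = W / 2"
    unfolding W_def by (simp add: mult.commute)
  ultimately have "0 \<le> \<Delta>t * a\<^sup>2 - \<Delta>s * b\<^sup>2 + W" by linarith
  then show ?thesis unfolding W_def .
qed

text \<open>
By \<open>remainder_mono\<close> the second-order difference quotients increase along the geodesic. At an
arbitrary \<open>t\<close> they are therefore caught between those at good times on either side, and continuity
of \<open>z\<close> closes the gap.
\<close>
lemma second_derivative_everywhere:
  assumes z: "continuous_on {0<..<1} z"
    and dense: "\<And>a b. 0 \<le> a \<Longrightarrow> a < b \<Longrightarrow> b \<le> 1 \<Longrightarrow>
      \<exists>s. a < s \<and> s < b \<and> has_second_derivative (\<lambda>\<tau>. F \<tau> (\<gamma> s)) (z s) s"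
    and t: "0 < t" "t < 1"
  shows "has_second_derivative (\<lambda>\<tau>. F \<tau> (\<gamma> t)) (z t) t"
  unfolding has_second_derivative_remainder[OF t]
proof (rule tendstoI)
  fix e :: real assume e: "e > 0"
  have "isCont z t" using z t by (simp add: continuous_on_eq_continuous_at)
  then obtain d where d: "d > 0" and zd: "\<And>s. \<bar>s - t\<bar> < d \<Longrightarrow> \<bar>z s - z t\<bar> < e"
    using e unfolding continuous_at_eps_delta by (metis dist_real_def)
  obtain s where s: "max 0 (t - d) < s" "s < t" and ds: "has_second_derivative (\<lambda>\<tau>. F \<tau> (\<gamma> s)) (z s) s"
    using dense[of "max 0 (t - d)" t] t d by auto
  obtain u where u: "t < u" "u < min 1 (t + d)" and du: "has_second_derivative (\<lambda>\<tau>. F \<tau> (\<gamma> u)) (z u) u"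
    using dense[of t "min 1 (t + d)"] t d by auto
  have lims: "((\<lambda>\<epsilon>. remainder s \<epsilon> / \<epsilon>\<^sup>2) \<longlongrightarrow> z s / 2) (at 0)" "((\<lambda>\<epsilon>. remainder u \<epsilon> / \<epsilon>\<^sup>2) \<longlongrightarrow> z u / 2) (at 0)"
    using ds du s u t has_second_derivative_remainder by auto
  have zs: "z t - e < z s" and zu: "z u < z t + e" using zd[of s] zd[of u] s u by auto
  have "eventually (\<lambda>\<epsilon>. z t / 2 - e < remainder s \<epsilon> / \<epsilon>\<^sup>2) (at 0)"
    using zs e by (intro order_tendstoD(1)[OF lims(1)]) linarith
  moreover have "eventually (\<lambda>\<epsilon>. remainder u \<epsilon> / \<epsilon>\<^sup>2 < z t / 2 + e) (at 0)"
    using zu e by (intro order_tendstoD(2)[OF lims(2)]) linarith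
  moreover have "eventually (\<lambda>\<epsilon>. \<bar>\<epsilon>\<bar> < min s (1 - u)) (at 0)"
    using s u t by (auto simp: eventually_at intro!: exI[of _ "min s (1 - u)"])
  ultimately show "\<forall>\<^sub>F \<epsilon> in at 0. dist (remainder t \<epsilon> / \<epsilon>\<^sup>2) (z t / 2) < e"
  proof eventually_elim
    case (elim \<epsilon>)
    have "remainder s \<epsilon> \<le> remainder t \<epsilon>" "remainder t \<epsilon> \<le> remainder u \<epsilon>"
      using elim s u t by (intro remainder_mono; force)+
    then have "remainder s \<epsilon> / \<epsilon>\<^sup>2 \<le> remainder t \<epsilon> / \<epsilon>\<^sup>2" "remainder t \<epsilon> / \<epsilon>\<^sup>2 \<le> remainder u \<epsilon> / \<epsilon>\<^sup>2"
      by (auto intro: divide_right_mono)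
    then show ?case using elim unfolding dist_real_def by linarith
  qed
qed

end

section \<open>The discrete Riccati inequality\<close>

text \<open>
The form is the discrete version of the Riccati inequality \<open>z' \<ge> z\<^sup>2 / K\<close>. Nonnegativity of its
determinant gives the first bound, and with it the second one if \<open>z s\<close> and \<open>z t\<close> have the same sign,
the square root being at most \<open>1\<close>.

For opposite signs the determinant gives only a negative lower bound. Instead, a solution of a
Riccati inequality that lives on all of \<open>(0, 1)\<close> obeys \<open>- K / s \<le> z s\<close> and \<open>z t \<le> K / (1 - t)\<close>, and the square root then
arises from two elementary estimates: the arithmetic-geometric mean inequality
\<open>sqrt (s (1 - t)) \<le> s + (1 - t)\<close>, and \<open>t - s \<le> sqrt (t (1 - s))\<close>.
\<close>
lemma riccati_chord_bound:
  fixes z :: "real \<Rightarrow> real"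
  assumes K: "K > 0"
    and form: "\<And>s t a b. 0 < s \<Longrightarrow> s < t \<Longrightarrow> t < 1 \<Longrightarrow>
      0 \<le> z t * a\<^sup>2 - z s * b\<^sup>2 + K / (t - s) * (a - b)\<^sup>2"
    and st: "0 < s" "s < t" "t < 1"
  shows "z s * z t / K \<le> (z t - z s) / (t - s)"
    and "sqrt ((s / t) * ((1 - t) / (1 - s))) * (\<bar>z s\<bar> * \<bar>z t\<bar> / K) \<le> (z t - z s) / (t - s)"
proof -
  have lower: "- K \<le> z t * t" if st: "0 < t" "t < 1" for t
  proof -
    have "((\<lambda>s. z t * (t - s)) \<longlongrightarrow> z t * (t - 0)) (at_right 0)" by (intro tendsto_intros)
    moreover have "eventually (\<lambda>s. - K \<le> z t * (t - s)) (at_right 0)"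
    proof (rule eventually_at_rightI[of 0 t])
      fix r assume r: "r \<in> {0<..<t}"
      then have "0 \<le> z t + K / (t - r)" using form[of r t 1 0] st by simp
      then show "- K \<le> z t * (t - r)" using r by (simp add: field_simps)
    qed (use st in auto)
    ultimately show ?thesis using tendsto_lowerbound by force
  qed
  have t_up: "z t * (1 - t) \<le> K"
  proof -
    have "((\<lambda>r. z t * (r - t)) \<longlongrightarrow> z t * (1 - t)) (at_left 1)" by (intro tendsto_intros)
    moreover have "eventually (\<lambda>r. z t * (r - t) \<le> K) (at_left 1)"
    proof (rule eventually_at_leftI[of t 1])
      fix r assume r: "r \<in> {t<..<1}"
      then have "z t \<le> K / (r - t)" using form[of t r 0 1] st by simp
      then show "z t * (r - t) \<le> K" using r by (simp add: field_simps)
    qed (use st in auto)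
    ultimately show ?thesis using tendsto_upperbound by force
  qed
  define h where "h = t - s"
  have h: "h > 0" "h < t" "h < 1 - s" using st by (auto simp: h_def)
  define A where "A = K / h"
  have A: "A > 0" using K h by (simp add: A_def)
  \<comment> \<open>The lower bound holds with \<open>t\<close> in place of \<open>h\<close>, and \<open>h < t\<close> makes it strict.\<close>
  have pos: "z t + A > 0"
  proof -
    have "K < A * t" using K h by (simp add: A_def pos_less_divide_eq)
    then have "0 < (z t + A) * t" using lower[of t] st by (simp add: distrib_right)
    then show ?thesis using st by (simp add: zero_less_mult_iff)
  qed
  have mono: "z s \<le> z t" using form[of s t 1 1] st by simp
  \<comment> \<open>For fixed \<open>b\<close>, the form is least at \<open>a = A b / (z t + A)\<close>.\<close>
  have "0 \<le> z t * A\<^sup>2 - z s * (z t + A)\<^sup>2 + A * (A - (z t + A))\<^sup>2"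
    using form[of s t A "z t + A"] st by (simp add: A_def h_def)
  also have "\<dots> = (z t + A) * (A * (z t - z s) - z s * z t)"
    by (simp add: power2_eq_square algebra_simps)
  finally have "z s * z t \<le> A * (z t - z s)" using pos by (simp add: zero_le_mult_iff)
  then show prod: "z s * z t / K \<le> (z t - z s) / (t - s)"
    using K h by (simp add: A_def h_def[symmetric] field_simps)
  let ?q = "sqrt ((s / t) * ((1 - t) / (1 - s)))"
  show "?q * (\<bar>z s\<bar> * \<bar>z t\<bar> / K) \<le> (z t - z s) / (t - s)"
  proof (cases "0 \<le> z s * z t")
    case True
    have "(s / t) * ((1 - t) / (1 - s)) \<le> 1 * 1"
      using st by (intro mult_mono) auto
    then have "?q \<le> 1" by simp
    then have "?q * (\<bar>z s\<bar> * \<bar>z t\<bar> / K) \<le> 1 * (\<bar>z s\<bar> * \<bar>z t\<bar> / K)"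
      using K by (intro mult_right_mono) auto
    also have "\<dots> = z s * z t / K" using True by (simp add: abs_mult[symmetric])
    finally show ?thesis using prod by linarith
  next
    case False
    then have sg: "z s < 0" "0 < z t" using mono by (auto simp: not_le mult_less_0_iff)
    define q where "q = sqrt (s * (1 - t))"
    define r where "r = sqrt (t * (1 - s))"
    have q: "q \<le> s + (1 - t)" "0 \<le> q"
      using arith_geo_mean_sqrt[of s "1 - t"] st by (auto simp: q_def)
    have hr: "h \<le> r" unfolding r_def
    proof (rule real_le_rsqrt)
      show "h\<^sup>2 \<le> t * (1 - s)" unfolding power2_eq_square using h by (intro mult_mono) auto
    qed
    have qr: "?q = q / r"
      by (simp add: q_def r_def real_sqrt_divide[symmetric])
    have "q * (- z s * z t) \<le> (s + (1 - t)) * (- z s * z t)"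
      using q sg by (intro mult_right_mono) (auto simp: mult_nonneg_nonpos2 mult_nonpos_nonneg)
    also have "\<dots> = (- (z s * s)) * z t + (z t * (1 - t)) * (- z s)" by (simp add: algebra_simps)
    also have "\<dots> \<le> K * z t + K * (- z s)"
      using lower[of s] t_up sg st by (intro add_mono mult_right_mono) auto
    finally have "q * (- z s * z t) / K \<le> z t - z s" using K by (simp add: field_simps)
    then have "q * (- z s * z t) / K / r \<le> (z t - z s) / r"
      using hr h by (intro divide_right_mono) auto
    also have "\<dots> \<le> (z t - z s) / h" using hr h mono by (intro divide_left_mono) auto
    finally show ?thesis unfolding qr using sg by (simp add: h_def[symmetric] mult.commute)
  qed
qed

lemma riccati_derivative_bound:
  fixes z :: "real \<Rightarrow> real"
  assumes chord: "\<And>s. t < s \<Longrightarrow> s < 1 \<Longrightarrow> z t * z s / K \<le> (z s - z t) / (s - t)"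
    and t: "t < 1" and z': "(z has_real_derivative z') (at t)"
  shows "(z t)\<^sup>2 / K \<le> z'"
proof -
  have "((\<lambda>s. (z s - z t) / (s - t)) \<longlongrightarrow> z') (at_right t)"
    using has_field_derivative_at_within[OF z'] unfolding has_field_derivative_iff .
  moreover have "(z \<longlongrightarrow> z t) (at_right t)"
    using DERIV_continuous[OF has_field_derivative_at_within[OF z']] unfolding continuous_within .
  then have "((\<lambda>s. z t * z s / K) \<longlongrightarrow> z t * z t / K) (at_right t)"
    unfolding divide_inverse by (intro tendsto_intros)
  moreover have "eventually (\<lambda>s. z t * z s / K \<le> (z s - z t) / (s - t)) (at_right t)"
    using t chord by (intro eventually_at_rightI[of t 1]) auto
  ultimately show ?thesis unfolding power2_eq_square using tendsto_le[of "at_right t"] by fastforce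
qed

section \<open>Time reversal and the theorem\<close>

lemma AE_unit_interval_dense:
  assumes AE: "AE t\<in>{0<..<1} in lborel. P (t::real)" and ab: "0 \<le> a" "a < b" "b \<le> 1"
  shows "\<exists>s. a < s \<and> s < b \<and> P s"
proof (rule ccontr)
  assume "\<not> ?thesis"
  then have "AE s in lborel. s \<notin> {a<..<b}" using AE ab by (auto elim!: eventually_mono)
  then have "emeasure lborel {s \<in> space lborel. s \<in> {a<..<b}} = 0"
    by (rule emeasure_eq_0_AE)
  moreover have "{s \<in> space lborel. s \<in> {a<..<b}} = {a<..<b}" by auto
  ultimately have "emeasure lborel {a<..<b} = 0" by metis
  then show False using ab by simp
qed

lemma c_transform_dual:
  assumes "\<bar>\<phi> y\<bar> \<noteq> \<infinity>"
  shows "\<phi> y + c_transform p \<phi> z \<le> ereal (dist y z powr p / p)"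
proof -
  obtain r where r: "\<phi> y = ereal r" using assms by auto
  have "c_transform p \<phi> z \<le> ereal (dist z y powr p / p) - \<phi> y"
    unfolding c_transform_def by (rule INF_lower) simp
  then show ?thesis by (cases "c_transform p \<phi> z") (auto simp: r dist_commute)
qed

lemma interp_bar_reflect: "interp_bar p \<phi> \<tau> x = - interp p (c_transform p \<phi>) (1 - \<tau>) x"
  by (simp add: interp_bar_def interp_def)

lemma ell_bar_reflect: "ell_bar p \<phi> \<tau> x = ell p (c_transform p \<phi>) (1 - \<tau>) x"
  by (simp add: ell_bar_def ell_def ell_bar_plus_def ell_plus_def)

lemma D_ell_bar_reflect: "\<tau> \<in> D_ell_bar p \<phi> x \<longleftrightarrow> 1 - \<tau> \<in> D_ell p (c_transform p \<phi>) x"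
  by (auto simp: D_ell_bar_def D_ell_def ell_bar_plus_def ell_plus_def ell_bar_minus_def ell_minus_def)

lemma (in calibrated_pair) reversed: "calibrated_pair p g f (\<lambda>s. \<gamma> (1 - s))"
proof
  show "is_geodesic (\<lambda>s. \<gamma> (1 - s))"
    unfolding is_geodesic_def
  proof (intro ballI)
    fix s t :: real assume "s \<in> {0..1}" "t \<in> {0..1}"
    then have "1 - s \<in> {0..1}" "1 - t \<in> {0..1}" by auto
    then have "dist (\<gamma> (1 - s)) (\<gamma> (1 - t)) = \<bar>(1 - s) - (1 - t)\<bar> * dist (\<gamma> 0) (\<gamma> 1)"
      using geod unfolding is_geodesic_def by blast
    also have "\<bar>(1 - s) - (1 - t)\<bar> = \<bar>s - t\<bar>" by (simp add: abs_minus_commute)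
    finally show "dist (\<gamma> (1 - s)) (\<gamma> (1 - t)) = \<bar>s - t\<bar> * dist (\<gamma> (1 - 0)) (\<gamma> (1 - 1))"
      by (simp add: dist_commute)
  qed
  show "g y + f z \<le> ereal (dist y z powr p / p)" for y z
    using dual[of z y] by (simp add: add.commute dist_commute)
  show "g (\<gamma> (1 - 0)) + f (\<gamma> (1 - 1)) = ereal (dist (\<gamma> (1 - 0)) (\<gamma> (1 - 1)) powr p / p)"
    using calibrated by (simp add: add.commute dist_commute)
qed (auto simp: p f_less g_less)

theorem theorem3p19:
  fixes p :: real
    and \<phi> :: "'a::metric_space \<Rightarrow> ereal"
    and \<gamma> :: "real \<Rightarrow> 'a"
    and z :: "real \<Rightarrow> real"
  assumes proper: "\<forall>(x::'a) r. compact (cball x r)"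
    and geodesic: "\<forall>x y::'a. \<exists>\<eta>. is_geodesic \<eta> \<and> \<eta> 0 = x \<and> \<eta> 1 = y"
    and p: "p > 1"
    and potential: "kantorovich_potential p \<phi>"
    and real_valued: "\<forall>x. \<bar>\<phi> x\<bar> \<noteq> \<infinity>"
    and kgeod: "\<gamma> \<in> kantorovich_geodesics p \<phi>"
    and length_pos: "geodesic_length \<gamma> > 0"
    and dagger: "AE t\<in>{0<..<1} in lborel.
          twice_differentiable_at (\<lambda>\<tau>. interp p \<phi> \<tau> (\<gamma> t)) t \<and>
          twice_differentiable_at (\<lambda>\<tau>. interp_bar p \<phi> \<tau> (\<gamma> t)) t"
    and second_derivs_eq: "AE t\<in>{0<..<1} in lborel.
          second_deriv (\<lambda>\<tau>. interp p \<phi> \<tau> (\<gamma> t)) t =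
          second_deriv (\<lambda>\<tau>. interp_bar p \<phi> \<tau> (\<gamma> t)) t"
    and z_cont: "continuous_on {0<..<1} z"
    and z_eq: "AE t\<in>{0<..<1} in lborel.
          second_deriv (\<lambda>\<tau>. interp p \<phi> \<tau> (\<gamma> t)) t = z t \<and>
          second_deriv (\<lambda>\<tau>. interp_bar p \<phi> \<tau> (\<gamma> t)) t = z t"
  shows "(\<forall>t\<in>{0<..<1}.
            twice_differentiable_at (\<lambda>\<tau>. interp p \<phi> \<tau> (\<gamma> t)) t \<and>
            twice_differentiable_at (\<lambda>\<tau>. interp_bar p \<phi> \<tau> (\<gamma> t)) t \<and>
            second_deriv (\<lambda>\<tau>. interp p \<phi> \<tau> (\<gamma> t)) t = z t \<and>
            second_deriv (\<lambda>\<tau>. interp_bar p \<phi> \<tau> (\<gamma> t)) t = z t \<and>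
            t \<in> D_ell p \<phi> (\<gamma> t) \<and>
            ((\<lambda>\<tau>. (p - 1) * ell p \<phi> \<tau> (\<gamma> t) powr p / p) has_real_derivative z t)
              (at t within D_ell p \<phi> (\<gamma> t)) \<and>
            t \<in> D_ell_bar p \<phi> (\<gamma> t) \<and>
            ((\<lambda>\<tau>. (p - 1) * ell_bar p \<phi> \<tau> (\<gamma> t) powr p / p) has_real_derivative z t)
              (at t within D_ell_bar p \<phi> (\<gamma> t)))
       \<and> (\<forall>s t. 0 < s \<and> s < t \<and> t < 1 \<longrightarrow>
            (z t - z s) / (t - s) \<ge>
              sqrt ((s / t) * ((1 - t) / (1 - s))) *
                (\<bar>z s\<bar> * \<bar>z t\<bar> / ((p - 1) * geodesic_length \<gamma> powr p)))
       \<and> (\<forall>t\<in>{0<..<1}. \<forall>z'. (z has_real_derivative z') (at t) \<longrightarrow>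
            z' \<ge> (z t)\<^sup>2 / ((p - 1) * geodesic_length \<gamma> powr p))"
proof -
  define \<psi> where "\<psi> = c_transform p \<phi>"
  define \<gamma>' where "\<gamma>' = (\<lambda>s. \<gamma> (1 - s))"
  interpret P: calibrated_pair p \<phi> \<psi> \<gamma>
  proof
    show "is_geodesic \<gamma>" "\<phi> (\<gamma> 0) + \<psi> (\<gamma> 1) = ereal (dist (\<gamma> 0) (\<gamma> 1) powr p / p)"
      using kgeod by (auto simp: kantorovich_geodesics_def \<psi>_def)
    show dual: "\<phi> y + \<psi> x \<le> ereal (dist y x powr p / p)" for x y
      unfolding \<psi>_def by (rule c_transform_dual) (rule real_valued[rule_format])
    show fin: "\<phi> y \<noteq> \<infinity>" for y using real_valued[rule_format, of y] by auto
    show "\<psi> y \<noteq> \<infinity>" for y using dual[of y y] real_valued[rule_format, of y] by auto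
  qed (rule p)
  interpret Q: calibrated_pair p \<psi> \<phi> \<gamma>'
    unfolding \<gamma>'_def by (rule P.reversed)
  define K where "K = (p - 1) * geodesic_length \<gamma> powr p"
  have K: "K > 0" using p length_pos by (simp add: K_def)

  have good: "AE t\<in>{0<..<1} in lborel. has_second_derivative (\<lambda>\<tau>. interp p \<phi> \<tau> (\<gamma> t)) (z t) t \<and>
      has_second_derivative (\<lambda>\<tau>. interp_bar p \<phi> \<tau> (\<gamma> t)) (z t) t"
    using dagger z_eq
  proof eventually_elim
    case (elim t)
    then show ?case using has_second_derivative_second_deriv by metis
  qed
  have P2: "has_second_derivative (\<lambda>\<tau>. interp p \<phi> \<tau> (\<gamma> t)) (z t) t" if "0 < t" "t < 1" for t
    by (rule P.second_derivative_everywhere[OF z_cont _ that])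
      (use AE_unit_interval_dense[OF good] in blast)
  \<comment> \<open>Time reversal changes the sign of the interpolation, hence that of the second derivative.\<close>
  have Q2: "has_second_derivative (\<lambda>\<tau>. interp p \<psi> \<tau> (\<gamma>' t)) (- z (1 - t)) t" if "0 < t" "t < 1" for t
  proof (rule Q.second_derivative_everywhere[OF _ _ that])
    show "continuous_on {0<..<1} (\<lambda>s. - z (1 - s))"
      by (intro continuous_intros continuous_on_compose2[OF z_cont]) auto
    fix a b :: real assume "0 \<le> a" "a < b" "b \<le> 1"
    then obtain s where s: "1 - b < s" "s < 1 - a"
      and ds: "has_second_derivative (\<lambda>\<tau>. interp_bar p \<phi> \<tau> (\<gamma> s)) (z s) s"
      using AE_unit_interval_dense[OF good, of "1 - b" "1 - a"] by auto
    have "has_second_derivative (\<lambda>\<tau>. interp p \<psi> \<tau> (\<gamma>' (1 - s))) (- z (1 - (1 - s))) (1 - s)"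
      using has_second_derivative_reflect[of _ _ "1 - s"] ds
      by (force simp: interp_bar_reflect \<psi>_def \<gamma>'_def)
    then show "\<exists>s>a. s < b \<and> has_second_derivative (\<lambda>\<tau>. interp p \<psi> \<tau> (\<gamma>' s)) (- z (1 - s)) s"
      using s by (intro exI[of _ "1 - s"]) auto
  qed
  have P2': "has_second_derivative (\<lambda>\<tau>. interp_bar p \<phi> \<tau> (\<gamma> t)) (z t) t" if "0 < t" "t < 1" for t
    using has_second_derivative_reflect[OF Q2[of "1 - t"]] that
    by (simp add: interp_bar_reflect \<psi>_def \<gamma>'_def)
  have bar: "t \<in> D_ell_bar p \<phi> (\<gamma> t)"
    "((\<lambda>\<tau>. (p - 1) * ell_bar p \<phi> \<tau> (\<gamma> t) powr p / p) has_real_derivative z t)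
       (at t within D_ell_bar p \<phi> (\<gamma> t))" if t: "0 < t" "t < 1" for t
  proof -
    have u: "0 < 1 - t" "1 - t < 1" using t by auto
    show "t \<in> D_ell_bar p \<phi> (\<gamma> t)"
      using Q.calibrated_in_D_ell(1)[OF u] by (simp add: D_ell_bar_reflect \<psi>_def \<gamma>'_def)
    have "((\<lambda>\<tau>. (p - 1) * ell p \<psi> \<tau> (\<gamma> t) powr p / p) has_real_derivative - z t)
        (at (1 - t) within D_ell p \<psi> (\<gamma> t))"
      using Q.speed_has_derivative[OF u Q2[OF u]] by (simp add: \<gamma>'_def)
    moreover have "(\<lambda>\<tau>. 1 - \<tau>) ` D_ell_bar p \<phi> (\<gamma> t) \<subseteq> D_ell p \<psi> (\<gamma> t)"
      by (auto simp: D_ell_bar_reflect \<psi>_def)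
    ultimately have "((\<lambda>\<tau>. (p - 1) * ell p \<psi> \<tau> (\<gamma> t) powr p / p) has_real_derivative - z t)
        (at (1 - t) within (\<lambda>\<tau>. 1 - \<tau>) ` D_ell_bar p \<phi> (\<gamma> t))"
      by (rule has_field_derivative_subset)
    moreover have "((\<lambda>\<tau>. 1 - \<tau>) has_real_derivative - 1) (at t within D_ell_bar p \<phi> (\<gamma> t))"
      by (auto intro!: derivative_eq_intros)
    ultimately have "((\<lambda>\<tau>. (p - 1) * ell p \<psi> (1 - \<tau>) (\<gamma> t) powr p / p) has_real_derivative - z t * - 1)
        (at t within D_ell_bar p \<phi> (\<gamma> t))"
      using DERIV_image_chain[of "\<lambda>\<tau>. (p - 1) * ell p \<psi> \<tau> (\<gamma> t) powr p / p" "- z t"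
          "\<lambda>\<tau>. 1 - \<tau>" t "D_ell_bar p \<phi> (\<gamma> t)" "- 1"] by (simp add: o_def)
    then show "((\<lambda>\<tau>. (p - 1) * ell_bar p \<phi> \<tau> (\<gamma> t) powr p / p) has_real_derivative z t)
       (at t within D_ell_bar p \<phi> (\<gamma> t))"
      by (simp add: ell_bar_reflect \<psi>_def)
  qed
  have form: "0 \<le> z t * a\<^sup>2 - z s * b\<^sup>2 + K / (t - s) * (a - b)\<^sup>2" if "0 < s" "s < t" "t < 1" for s t a b
    unfolding K_def by (rule P.second_derivative_form[OF that P2 P2]) (use that in auto)
  show ?thesis
    unfolding K_def[symmetric]
  proof (intro conjI ballI allI impI)
    fix t :: real assume "t \<in> {0<..<1}"
    then have t: "0 < t" "t < 1" by auto
    show "twice_differentiable_at (\<lambda>\<tau>. interp p \<phi> \<tau> (\<gamma> t)) t"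
      "twice_differentiable_at (\<lambda>\<tau>. interp_bar p \<phi> \<tau> (\<gamma> t)) t"
      unfolding twice_differentiable_at_def using P2[OF t] P2'[OF t] by blast+
    show "second_deriv (\<lambda>\<tau>. interp p \<phi> \<tau> (\<gamma> t)) t = z t"
      "second_deriv (\<lambda>\<tau>. interp_bar p \<phi> \<tau> (\<gamma> t)) t = z t"
      by (rule second_deriv_eq[OF P2[OF t]], rule second_deriv_eq[OF P2'[OF t]])
    show "t \<in> D_ell p \<phi> (\<gamma> t)" by (rule P.calibrated_in_D_ell[OF t])
    show "((\<lambda>\<tau>. (p - 1) * ell p \<phi> \<tau> (\<gamma> t) powr p / p) has_real_derivative z t) (at t within D_ell p \<phi> (\<gamma> t))"
      by (rule P.speed_has_derivative[OF t P2[OF t]])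
  next
    fix t :: real assume "t \<in> {0<..<1}"
    then have t: "0 < t" "t < 1" by auto
    show "t \<in> D_ell_bar p \<phi> (\<gamma> t)"
      "((\<lambda>\<tau>. (p - 1) * ell_bar p \<phi> \<tau> (\<gamma> t) powr p / p) has_real_derivative z t)
         (at t within D_ell_bar p \<phi> (\<gamma> t))"
      by (rule bar[OF t])+
    show "(z t)\<^sup>2 / K \<le> z'" if "(z has_real_derivative z') (at t)" for z'
      using riccati_chord_bound(1)[OF K form] t that by (intro riccati_derivative_bound) auto
  next
    fix s t :: real assume "0 < s \<and> s < t \<and> t < 1"
    then show "sqrt ((s / t) * ((1 - t) / (1 - s))) * (\<bar>z s\<bar> * \<bar>z t\<bar> / K) \<le> (z t - z s) / (t - s)"
      by (intro riccati_chord_bound(2)[OF K form]) auto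
  qed
qed

end
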